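(* Let $\mathsf{k}\ge1$ and let $\mathfrak{m}=(m_1,\dots,m_{\mathsf{k}})\in\mathbb{Z}^{\mathsf{k}}$ with $m_i\neq0$ for all $i$. Let $\mathcal{F}$ be the fixed point algebra of the gauge action on $\mathcal{O}_{\Lambda(\mathds{1}_{\mathsf{k}},\mathfrak{m})}$ and $\mathcal{F}'$ its relative commutant in $\mathcal{O}_{\Lambda(\mathds{1}_{\mathsf{k}},\mathfrak{m})}$. Then $\mathcal{F}'$ is a Cartan subalgebra of $\mathcal{O}_{\Lambda(\mathds{1}_{\mathsf{k}},\mathfrak{m})}$.
   Context: Write $\mathbb{Z}=\langle a\rangle$ multiplicatively, $\mathds{1}_{\mathsf k}=(1,\dots,1)\in\mathbb{N}^{\mathsf k}$, and $\mathfrak{m}^{\mathbf{p}}=\prod_i m_i^{p_i}$ for $\mathbf{p}\in\mathbb{N}^{\mathsf{k}}$. $\Lambda_{\mathds{1}_{\mathsf{k}}}$ is the single-vertex $\mathsf{k}$-graph with exactly one edge $\mathbf{x}_i$ of each colour $i$; as a monoid it is the free commutative monoid on $\mathbf{x}_1,\dots,\mathbf{x}_{\mathsf{k}}$, with degree map $d(\mathbf{x}_1^{p_1}\cdots\mathbf{x}_{\mathsf{k}}^{p_{\mathsf{k}}})=(p_1,\dots,p_{\mathsf{k}})$. $\Lambda(\mathds{1}_{\mathsf{k}},\mathfrak{m})$ is the self-similar $\mathsf{k}$-graph $(\mathbb{Z},\Lambda_{\mathds{1}_{\mathsf{k}}})$ in which $\mathbb{Z}$ acts trivially, $a^\ell\cdot\mu=\mu$,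 with restriction $a^\ell|_\mu=a^{\ell\mathfrak{m}^{d(\mu)}}$. $\mathcal{O}_{\Lambda(\mathds{1}_{\mathsf{k}},\mathfrak{m})}$ is the universal unital C*-algebra generated by unitaries $\{u_g\}_{g\in\mathbb{Z}}$ and isometries $\{s_\mu:\mu\in\Lambda_{\mathds{1}_{\mathsf{k}}}\}$ with $u_{gh}=u_gu_h$, $s_\mu s_\nu=s_{\mu\nu}$, $s_\mu s_\mu^*=1$ for all $\mu$ (so each $s_\mu$ is unitary), and $u_gs_\mu=s_{\mu}u_{g|_\mu}$. The gauge action $\gamma$ of $\mathbb{T}^{\mathsf{k}}$ is $\gamma_{\mathbf{t}}(s_\mu u_gs_\nu^* )=\mathbf{t}^{d(\mu)-d(\nu)}s_\mu u_gs_\nu^*$. An abelian C*-subalgebra $\mathcal{B}$ of a C*-algebra $\mathcal{A}$ is a Cartan subalgebra if: (i) $\mathcal{B}$ contains an approximate unit of $\mathcal{A}$; (ii) $\mathcal{B}$ is a maximal abelian subalgebra (MASA); (iii) the normalizer set $\{x\in\mathcal{A}: x\mathcal{B}x^*\cup x^*\mathcal{B}x\subseteq\mathcal{B}\}$ generates $\mathcal{A}$; (iv) there is a faithful conditional expectation from $\mathcal{A}$ onto $\mathcal{B}$. *)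

theory Defs
  imports "HOL-Analysis.Analysis" "HOL-Library.Poly_Mapping" "HOL-Library.Multiset"
begin

section \<open>Unital C*-algebras\<close>

text \<open>The sort \<^class>\<open>real_normed_algebra_1\<close> makes the algebra unital and nonzero, with a
  submultiplicative norm and \<open>norm 1 = 1\<close>; \<^class>\<open>banach\<close> adds completeness.\<close>

class unital_cstar_algebra = banach + real_normed_algebra_1 +
  fixes scaleC :: "complex \<Rightarrow> 'a \<Rightarrow> 'a" (infixr "*\<^sub>C" 75)
    and adj :: "'a \<Rightarrow> 'a"
  assumes scaleR_scaleC: "scaleR r x = complex_of_real r *\<^sub>C x"
    and scaleC_add_right: "c *\<^sub>C (x + y) = c *\<^sub>C x + c *\<^sub>C y"
    and scaleC_add_left: "(c + d) *\<^sub>C x = c *\<^sub>C x + d *\<^sub>C x"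
    and scaleC_scaleC: "c *\<^sub>C d *\<^sub>C x = (c * d) *\<^sub>C x"
    and scaleC_one: "1 *\<^sub>C x = x"
    and mult_scaleC_left: "(c *\<^sub>C x) * y = c *\<^sub>C (x * y)"
    and mult_scaleC_right: "x * (c *\<^sub>C y) = c *\<^sub>C (x * y)"
    and norm_scaleC: "norm (c *\<^sub>C x) = cmod c * norm x"
    and adj_add: "adj (x + y) = adj x + adj y"
    and adj_scaleC: "adj (c *\<^sub>C x) = cnj c *\<^sub>C adj x"
    and adj_mult: "adj (x * y) = adj y * adj x"
    and adj_adj: "adj (adj x) = x"
    and norm_adj_mult: "norm (adj x * x) = (norm x)\<^sup>2"

definition star_hom :: "('a::unital_cstar_algebra \<Rightarrow> 'b::unital_cstar_algebra) \<Rightarrow> bool" where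
  "star_hom \<phi> \<longleftrightarrow>
     (\<forall>x y. \<phi> (x + y) = \<phi> x + \<phi> y) \<and> (\<forall>c x. \<phi> (c *\<^sub>C x) = c *\<^sub>C \<phi> x) \<and>
     (\<forall>x y. \<phi> (x * y) = \<phi> x * \<phi> y) \<and> (\<forall>x. \<phi> (adj x) = adj (\<phi> x))"

definition star_automorphism :: "('a::unital_cstar_algebra \<Rightarrow> 'a) \<Rightarrow> bool" where
  "star_automorphism \<phi> \<longleftrightarrow> star_hom \<phi> \<and> bij \<phi>"

text \<open>C*-subalgebras are not required to contain the unit of the ambient algebra.\<close>

definition cstar_subalgebra :: "'a::unital_cstar_algebra set \<Rightarrow> bool" where
  "cstar_subalgebra B \<longleftrightarrow>
     0 \<in> B \<and> (\<forall>x\<in>B. \<forall>y\<in>B. x + y \<in> B) \<and> (\<forall>c. \<forall>x\<in>B. c *\<^sub>C x \<in> B) \<and>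
     (\<forall>x\<in>B. \<forall>y\<in>B. x * y \<in> B) \<and> (\<forall>x\<in>B. adj x \<in> B) \<and> closed B"

definition cstar_generated :: "'a::unital_cstar_algebra set \<Rightarrow> 'a set" where
  "cstar_generated X = \<Inter>{B. cstar_subalgebra B \<and> X \<subseteq> B}"

definition positive :: "'a::unital_cstar_algebra \<Rightarrow> bool" where
  "positive a \<longleftrightarrow> (\<exists>x. a = adj x * x)"

definition rel_commutant :: "'a::unital_cstar_algebra set \<Rightarrow> 'a set" where
  "rel_commutant X = {a. \<forall>x\<in>X. a * x = x * a}"


section \<open>Cartan subalgebras\<close>

definition abelian :: "'a::unital_cstar_algebra set \<Rightarrow> bool" where
  "abelian B \<longleftrightarrow> (\<forall>x\<in>B. \<forall>y\<in>B. x * y = y * x)"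

text \<open>A net in the algebra is represented by its image filter.\<close>

definition contains_approximate_unit :: "'a::unital_cstar_algebra set \<Rightarrow> bool" where
  "contains_approximate_unit B \<longleftrightarrow>
     (\<exists>F. F \<noteq> bot \<and> (\<forall>\<^sub>F e in F. e \<in> B \<and> positive e \<and> norm e \<le> 1) \<and>
       (\<forall>x. ((\<lambda>e. e * x) \<longlongrightarrow> x) F \<and> ((\<lambda>e. x * e) \<longlongrightarrow> x) F))"

definition masa :: "'a::unital_cstar_algebra set \<Rightarrow> bool" where
  "masa B \<longleftrightarrow> cstar_subalgebra B \<and> abelian B \<and>
     (\<forall>C. cstar_subalgebra C \<and> abelian C \<and> B \<subseteq> C \<longrightarrow> C = B)"

definition normalizer_set :: "'a::unital_cstar_algebra set \<Rightarrow> 'a set" where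
  "normalizer_set B = {x. \<forall>b\<in>B. x * b * adj x \<in> B \<and> adj x * b * x \<in> B}"

text \<open>Complete positivity follows from the bimodule property and positivity.\<close>

definition conditional_expectation ::
    "'a::unital_cstar_algebra set \<Rightarrow> ('a \<Rightarrow> 'a) \<Rightarrow> bool" where
  "conditional_expectation B E \<longleftrightarrow>
     (\<forall>x y. E (x + y) = E x + E y) \<and> (\<forall>c x. E (c *\<^sub>C x) = c *\<^sub>C E x) \<and>
     (\<forall>x. E x \<in> B) \<and> (\<forall>b\<in>B. E b = b) \<and>
     (\<forall>b\<in>B. \<forall>x. E (b * x) = b * E x \<and> E (x * b) = E x * b) \<and>
     (\<forall>x. positive x \<longrightarrow> positive (E x)) \<and> (\<forall>x. norm (E x) \<le> norm x)"

definition faithful :: "('a::unital_cstar_algebra \<Rightarrow> 'a) \<Rightarrow> bool" where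
  "faithful E \<longleftrightarrow> (\<forall>x. E (adj x * x) = 0 \<longrightarrow> x = 0)"

definition cartan_subalgebra :: "'a::unital_cstar_algebra set \<Rightarrow> bool" where
  "cartan_subalgebra B \<longleftrightarrow> cstar_subalgebra B \<and> abelian B \<and>
     contains_approximate_unit B \<and>
     masa B \<and>
     cstar_generated (normalizer_set B) = UNIV \<and>
     (\<exists>E. conditional_expectation B E \<and> faithful E)"


section \<open>Universal unital C*-algebras\<close>

text \<open>The free unital *-algebra on a set of generators \<open>'g\<close> is the monoid algebra over the complex
  numbers of the free monoid of words in the letters \<open>x\<close> and \<open>x*\<close>, for \<open>x\<close> in \<open>'g\<close>. The monoid is
  written additively so that \<^type>\<open>poly_mapping\<close> supplies the convolution product.\<close>

datatype 'g letter = Plain 'g | Starred 'g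

datatype 'g word = Word (letters: "'g letter list")

instantiation word :: (type) monoid_add
begin
definition zero_word :: "'a word" where "0 = Word []"
definition plus_word :: "'a word \<Rightarrow> 'a word \<Rightarrow> 'a word" where
  "v + w = Word (letters v @ letters w)"
instance by standard (simp_all add: zero_word_def plus_word_def)
end

type_synonym 'g free_star_algebra = "'g word \<Rightarrow>\<^sub>0 complex"

fun star_letter :: "'g letter \<Rightarrow> 'g letter" where
  "star_letter (Plain x) = Starred x"
| "star_letter (Starred x) = Plain x"

definition star_word :: "'g word \<Rightarrow> 'g word" where
  "star_word w = Word (rev (map star_letter (letters w)))"

text \<open>\<^const>\<open>star_word\<close> is an involution, so \<^const>\<open>Poly_Mapping.map_key\<close> moves the coefficient of a word
  to the starred word.\<close>

definition star_free :: "'g free_star_algebra \<Rightarrow> 'g free_star_algebra" where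
  "star_free p = Poly_Mapping.map cnj (Poly_Mapping.map_key star_word p)"

definition scale_free :: "complex \<Rightarrow> 'g free_star_algebra \<Rightarrow> 'g free_star_algebra" where
  "scale_free c p = Poly_Mapping.single 0 c * p"

definition gen :: "'g \<Rightarrow> 'g free_star_algebra" where
  "gen x = Poly_Mapping.single (Word [Plain x]) 1"

fun eval_letter :: "('g \<Rightarrow> 'a::unital_cstar_algebra) \<Rightarrow> 'g letter \<Rightarrow> 'a" where
  "eval_letter \<rho> (Plain x) = \<rho> x"
| "eval_letter \<rho> (Starred x) = adj (\<rho> x)"

definition eval_word :: "('g \<Rightarrow> 'a::unital_cstar_algebra) \<Rightarrow> 'g word \<Rightarrow> 'a" where
  "eval_word \<rho> w = prod_list (map (eval_letter \<rho>) (letters w))"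

definition eval_free :: "('g \<Rightarrow> 'a::unital_cstar_algebra) \<Rightarrow> 'g free_star_algebra \<Rightarrow> 'a" where
  "eval_free \<rho> p =
     (\<Sum>w\<in>Poly_Mapping.keys p. Poly_Mapping.lookup p w *\<^sub>C eval_word \<rho> w)"

definition cstar_seminorm :: "('g free_star_algebra \<Rightarrow> real) \<Rightarrow> bool" where
  "cstar_seminorm q \<longleftrightarrow>
     (\<forall>p r. q (p + r) \<le> q p + q r) \<and> (\<forall>c p. q (scale_free c p) = cmod c * q p) \<and>
     (\<forall>p r. q (p * r) \<le> q p * q r) \<and> (\<forall>p. q (star_free p * p) = (q p)\<^sup>2)"

text \<open>The universal unital C*-algebra for a set \<open>R\<close> of relators is the completion of the free unital
  *-algebra in the largest C*-seminorm that vanishes on \<open>R\<close>. A C*-algebra \<open>'a\<close> with a family \<open>\<iota>\<close> of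
  elements is (a copy of) it iff \<open>\<iota>\<close> satisfies the relations, generates \<open>'a\<close>, and induces this
  largest seminorm. Seminorms are used because HOL cannot quantify over all target algebras inside
  a formula; \<open>universal_property\<close> below is the resulting universal property, for
  target algebras of an arbitrary type.\<close>

definition satisfies_relators ::
    "'g free_star_algebra set \<Rightarrow> ('g \<Rightarrow> 'a::unital_cstar_algebra) \<Rightarrow> bool" where
  "satisfies_relators R \<rho> \<longleftrightarrow> (\<forall>r\<in>R. eval_free \<rho> r = 0)"

definition universal_cstar_algebra ::
    "'g free_star_algebra set \<Rightarrow> ('g \<Rightarrow> 'a::unital_cstar_algebra) \<Rightarrow> bool" where
  "universal_cstar_algebra R \<iota> \<longleftrightarrow>
     satisfies_relators R \<iota> \<and>
     cstar_generated (insert 1 (range \<iota>)) = UNIV \<and>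
     (\<forall>q. cstar_seminorm q \<and> (\<forall>r\<in>R. q r = 0) \<longrightarrow> (\<forall>p. q p \<le> norm (eval_free \<iota> p)))"


section \<open>The C*-algebra of the self-similar graph\<close>

text \<open>The free commutative monoid on \<open>{x\<^sub>i. i \<in> 'k}\<close> is \<open>'k multiset\<close>, written additively; the degree
  of \<open>\<mu>\<close> is \<open>count \<mu>\<close>. The element \<open>a\<^sup>l\<close> of the infinite cyclic group is represented by its
  exponent \<open>l :: int\<close>, so the product of group elements is addition of exponents.\<close>

type_synonym 'k path = "'k multiset"

definition restriction :: "('k::finite \<Rightarrow> int) \<Rightarrow> int \<Rightarrow> 'k path \<Rightarrow> int" where
  "restriction m l \<mu> = l * (\<Prod>i\<in>UNIV. m i ^ count \<mu> i)"

datatype 'k generator = U int | S "'k path"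

text \<open>The relations are written out for an arbitrary target algebra in
  \<open>satisfies_relators_iff\<close> below.\<close>

definition relators :: "('k::finite \<Rightarrow> int) \<Rightarrow> 'k generator free_star_algebra set" where
  "relators m =
     {star_free (gen (U g)) * gen (U g) - 1 | g. True} \<union>
     {gen (U g) * star_free (gen (U g)) - 1 | g. True} \<union>
     {star_free (gen (S \<mu>)) * gen (S \<mu>) - 1 | \<mu>. True} \<union>
     {gen (S \<mu>) * star_free (gen (S \<mu>)) - 1 | \<mu>. True} \<union>
     {gen (U (g + h)) - gen (U g) * gen (U h) | g h. True} \<union>
     {gen (S \<mu>) * gen (S \<nu>) - gen (S (\<mu> + \<nu>)) | \<mu> \<nu>. True} \<union>
     {gen (U g) * gen (S \<mu>) - gen (S \<mu>) * gen (U (restriction m g \<mu>)) | g \<mu>. True}"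

definition torus :: "('k \<Rightarrow> complex) set" where
  "torus = {t. \<forall>i. cmod (t i) = 1}"

definition gauge_char :: "('k::finite \<Rightarrow> complex) \<Rightarrow> 'k path \<Rightarrow> 'k path \<Rightarrow> complex" where
  "gauge_char t \<mu> \<nu> = (\<Prod>i\<in>UNIV. t i powi (int (count \<mu> i) - int (count \<nu> i)))"

text \<open>A *-automorphism of a C*-algebra is automatically continuous; requiring it here only shortens
  the uniqueness argument. Existence and uniqueness are \<open>ex1_gauge_action\<close> below.\<close>

definition gauge_action ::
    "('k::finite generator \<Rightarrow> 'a::unital_cstar_algebra) \<Rightarrow> ('k \<Rightarrow> complex) \<Rightarrow> 'a \<Rightarrow> 'a" where
  "gauge_action \<iota> t = (THE \<gamma>. star_automorphism \<gamma> \<and> continuous_on UNIV \<gamma> \<and>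
     (\<forall>\<mu> g \<nu>. \<gamma> (\<iota> (S \<mu>) * \<iota> (U g) * adj (\<iota> (S \<nu>))) =
        gauge_char t \<mu> \<nu> *\<^sub>C (\<iota> (S \<mu>) * \<iota> (U g) * adj (\<iota> (S \<nu>)))))"

definition gauge_fixed_algebra ::
    "('k::finite generator \<Rightarrow> 'a::unital_cstar_algebra) \<Rightarrow> 'a set" where
  "gauge_fixed_algebra \<iota> = {x. \<forall>t\<in>torus. gauge_action \<iota> t x = x}"


section \<open>The universal property and existence of the gauge action\<close>

lemma scaleC_zero_left [simp]: "0 *\<^sub>C (x::'a::unital_cstar_algebra) = 0"
  using scaleC_add_left[of 0 0 x] by simp

lemma scaleC_zero_right [simp]: "c *\<^sub>C (0::'a::unital_cstar_algebra) = 0"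
  using scaleC_add_right[of c 0 "0::'a"] by simp

lemma scaleC_sum_right: "c *\<^sub>C (\<Sum>i\<in>I. f i :: 'a::unital_cstar_algebra) = (\<Sum>i\<in>I. c *\<^sub>C f i)"
  by (induction I rule: infinite_finite_induct) (auto simp: scaleC_add_right)

lemma adj_zero [simp]: "adj (0::'a::unital_cstar_algebra) = 0"
  using adj_add[of 0 "0::'a"] by simp

lemma adj_one [simp]: "adj (1::'a::unital_cstar_algebra) = 1"
  by (metis adj_adj adj_mult mult_1_right)

lemma adj_minus: "adj (- x) = - adj (x::'a::unital_cstar_algebra)"
  using adj_add[of x "-x"] by (simp add: eq_neg_iff_add_eq_0 add.commute)

lemma norm_adj [simp]: "norm (adj (x::'a::unital_cstar_algebra)) = norm x"
proof -
  have le: "norm y \<le> norm (adj y)" for y :: 'a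
  proof (cases "y = 0")
    case False
    have "norm y * norm y \<le> norm (adj y) * norm y"
      using norm_mult_ineq[of "adj y" y] by (simp add: norm_adj_mult power2_eq_square)
    with False show ?thesis by simp
  qed simp
  show ?thesis using le[of x] le[of "adj x"] by (simp add: adj_adj)
qed

lemma adj_diff: "adj (x - y) = adj x - adj (y::'a::unital_cstar_algebra)"
  using adj_add[of x "-y"] by (simp add: adj_minus)

lemma continuous_adj: "continuous_on UNIV (adj :: 'a::unital_cstar_algebra \<Rightarrow> 'a)"
proof (rule continuous_on_iff[THEN iffD2], intro ballI allI impI)
  fix x :: 'a and e :: real assume "e > 0"
  then show "\<exists>d>0. \<forall>y\<in>UNIV. dist y x < d \<longrightarrow> dist (adj y) (adj x) < e"
    by (intro exI[of _ e]) (simp add: dist_norm flip: adj_diff)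
qed

lemma scaleC_minus_right: "c *\<^sub>C (- x) = - (c *\<^sub>C (x::'a::unital_cstar_algebra))"
  using scaleC_add_right[of c x "-x"] by (simp add: eq_neg_iff_add_eq_0 add.commute)

lemma scaleC_diff_right: "c *\<^sub>C (x - y) = c *\<^sub>C x - c *\<^sub>C (y::'a::unital_cstar_algebra)"
  using scaleC_add_right[of c x "-y"] by (simp add: scaleC_minus_right)

lemma continuous_scaleC: "continuous_on UNIV ((*\<^sub>C) c :: 'a::unital_cstar_algebra \<Rightarrow> 'a)"
proof -
  have "bounded_linear ((*\<^sub>C) c :: 'a \<Rightarrow> 'a)"
    by (rule bounded_linear_intro[of _ "cmod c"])
      (auto simp: scaleC_add_right scaleR_scaleC scaleC_scaleC norm_scaleC mult.commute)
  then show ?thesis by (simp add: linear_continuous_on)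
qed

lemma star_letter_star_letter [simp]: "star_letter (star_letter x) = x"
  by (cases x) auto

lemma star_word_star_word [simp]: "star_word (star_word w) = w"
  by (cases w) (simp add: star_word_def rev_map o_def)

lemma inj_star_word [simp]: "inj star_word"
  by (metis injI star_word_star_word)

lemma eval_word_zero [simp]: "eval_word \<rho> 0 = 1"
  by (simp add: eval_word_def zero_word_def)

lemma eval_word_plus: "eval_word \<rho> (v + w) = eval_word \<rho> v * eval_word \<rho> w"
  by (simp add: eval_word_def plus_word_def)

lemma eval_word_star: "eval_word \<rho> (star_word w) = adj (eval_word \<rho> w)"
proof -
  have l: "eval_letter \<rho> (star_letter x) = adj (eval_letter \<rho> x)" for x
    by (cases x) (auto simp: adj_adj)
  have "prod_list (map (eval_letter \<rho>) (rev (map star_letter xs))) =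
      adj (prod_list (map (eval_letter \<rho>) xs))" for xs
    by (induction xs) (auto simp: adj_mult l)
  then show ?thesis by (simp add: eval_word_def star_word_def)
qed

lemma eval_free_superset:
  assumes "finite A" "Poly_Mapping.keys p \<subseteq> A"
  shows "eval_free \<rho> p = (\<Sum>w\<in>A. Poly_Mapping.lookup p w *\<^sub>C eval_word \<rho> w)"
  unfolding eval_free_def
  by (rule sum.mono_neutral_left) (use assms in \<open>auto simp: in_keys_iff\<close>)

lemma eval_free_add: "eval_free \<rho> (p + r) = eval_free \<rho> p + eval_free \<rho> r"
proof -
  let ?A = "Poly_Mapping.keys p \<union> Poly_Mapping.keys r"
  have f: "finite ?A" by simp
  show ?thesis
    using eval_free_superset[OF f, of "p + r" \<rho>] eval_free_superset[OF f, of p \<rho>]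
      eval_free_superset[OF f, of r \<rho>] Poly_Mapping.keys_add[of p r]
    by (simp add: lookup_add scaleC_add_left sum.distrib)
qed

lemma eval_free_single: "eval_free \<rho> (Poly_Mapping.single w c) = c *\<^sub>C eval_word \<rho> w"
  by (simp add: eval_free_def)

lemma eval_free_zero [simp]: "eval_free \<rho> 0 = 0"
  by (simp add: eval_free_def)

lemma eval_free_minus: "eval_free \<rho> (- p) = - eval_free \<rho> p"
  using eval_free_add[of \<rho> p "-p"] by (simp add: eq_neg_iff_add_eq_0 add.commute)

lemma eval_free_diff: "eval_free \<rho> (p - r) = eval_free \<rho> p - eval_free \<rho> r"
  using eval_free_add[of \<rho> p "-r"] by (simp add: eval_free_minus)

lemma eval_free_one [simp]: "eval_free \<rho> 1 = 1"
  using eval_free_single[of \<rho> 0 1] by (simp add: scaleC_one)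

lemma free_induct [case_names zero single add]:
  fixes p :: "'g free_star_algebra"
  assumes "P 0" "\<And>w c. P (Poly_Mapping.single w c)" "\<And>p r. P p \<Longrightarrow> P r \<Longrightarrow> P (p + r)"
  shows "P p"
proof (induction p rule: Poly_Mapping.update_induct)
  case const then show ?case by (simp add: assms)
next
  case (update f a b)
  have "Poly_Mapping.update a b f = Poly_Mapping.single a b + f"
    by (rule poly_mapping_eqI)
      (use update in \<open>auto simp: lookup_update lookup_add lookup_single when_def in_keys_iff\<close>)
  then show ?case using update assms by simp
qed

lemma eval_free_mult: "eval_free \<rho> (p * r) = eval_free \<rho> p * eval_free \<rho> r"
proof (induction p rule: free_induct)
  case (single w c)
  show ?case
  proof (induction r rule: free_induct)
    case (single v d)
    then show ?case
      by (simp add: mult_single eval_free_single eval_word_plus mult_scaleC_left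
          mult_scaleC_right scaleC_scaleC mult.commute)
  qed (auto simp: distrib_left eval_free_add)
qed (auto simp: distrib_right eval_free_add)

lemma star_free_add: "star_free (p + r) = star_free p + star_free r"
proof (rule poly_mapping_eqI)
  have l: "Poly_Mapping.lookup (Poly_Mapping.map cnj q) w = cnj (Poly_Mapping.lookup q w)"
    for q :: "'a free_star_algebra" and w
    by (simp add: Poly_Mapping.map.rep_eq when_def)
  show "Poly_Mapping.lookup (star_free (p + r)) w = Poly_Mapping.lookup (star_free p + star_free r) w"
    for w
    by (simp add: star_free_def lookup_add map_key_plus l)
qed

lemma star_free_zero [simp]: "star_free 0 = 0"
  using star_free_add[of 0 0] by simp

lemma star_free_single:
  "star_free (Poly_Mapping.single w c) = Poly_Mapping.single (star_word w) (cnj c)"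
proof -
  have "Poly_Mapping.map_key star_word (Poly_Mapping.single (star_word (star_word w)) c) =
    Poly_Mapping.single (star_word w) c"
    by (rule map_key_single) simp
  then show ?thesis by (simp add: star_free_def map_single)
qed

lemma eval_free_star: "eval_free \<rho> (star_free p) = adj (eval_free \<rho> p)"
  by (induction p rule: free_induct)
    (auto simp: star_free_single eval_free_single eval_word_star adj_scaleC
      star_free_add eval_free_add adj_add)

lemma eval_free_scale: "eval_free \<rho> (scale_free c p) = c *\<^sub>C eval_free \<rho> p"
  by (simp add: scale_free_def eval_free_mult eval_free_single mult_scaleC_left)

lemma eval_free_gen [simp]: "eval_free \<rho> (gen x) = \<rho> x"
  by (simp add: gen_def eval_free_single eval_word_def scaleC_one)

lemma satisfies_relators_iff:
  fixes m :: "'k::finite \<Rightarrow> int"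
  shows "satisfies_relators (relators m) \<rho> \<longleftrightarrow>
    (\<forall>g. adj (\<rho> (U g)) * \<rho> (U g) = 1 \<and> \<rho> (U g) * adj (\<rho> (U g)) = 1) \<and>
    (\<forall>\<mu>. adj (\<rho> (S \<mu>)) * \<rho> (S \<mu>) = 1 \<and> \<rho> (S \<mu>) * adj (\<rho> (S \<mu>)) = 1) \<and>
    (\<forall>g h. \<rho> (U (g + h)) = \<rho> (U g) * \<rho> (U h)) \<and>
    (\<forall>\<mu> \<nu>. \<rho> (S \<mu>) * \<rho> (S \<nu>) = \<rho> (S (\<mu> + \<nu>))) \<and>
    (\<forall>g \<mu>. \<rho> (U g) * \<rho> (S \<mu>) = \<rho> (S \<mu>) * \<rho> (U (restriction m g \<mu>)))"
proof -
  have all1: "(\<forall>r\<in>{f x | x. True}. P r) \<longleftrightarrow> (\<forall>x. P (f x))"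
    for f :: "'x \<Rightarrow> 'k generator free_star_algebra" and P by blast
  have all2: "(\<forall>r\<in>{f x y | x y. True}. P r) \<longleftrightarrow> (\<forall>x y. P (f x y))"
    for f :: "'x \<Rightarrow> 'y \<Rightarrow> 'k generator free_star_algebra" and P by blast
  show ?thesis
    unfolding satisfies_relators_def relators_def ball_Un all1 all2 eval_free_diff eval_free_mult
      eval_free_star eval_free_gen eval_free_one right_minus_eq all_conj_distrib
    by (simp only: conj_assoc)
qed

lemma cstar_seminorm_eval: "cstar_seminorm (\<lambda>p. norm (eval_free \<rho> p))"
  unfolding cstar_seminorm_def
  by (simp add: eval_free_add eval_free_scale eval_free_mult eval_free_star norm_scaleC
      norm_adj_mult norm_triangle_ineq norm_mult_ineq)

lemma dense_range_eval:
  fixes \<iota> :: "'g \<Rightarrow> 'a::unital_cstar_algebra"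
  assumes "cstar_generated (insert 1 (range \<iota>)) = UNIV"
  shows "closure (range (eval_free \<iota>)) = UNIV"
proof -
  let ?D = "range (eval_free \<iota>)"
  have ap: "\<exists>s. (\<forall>n. s n \<in> ?D) \<and> s \<longlonglongrightarrow> x" if "x \<in> closure ?D" for x
    using that unfolding closure_sequential by blast
  have clI: "x \<in> closure ?D" if "\<And>n. s n \<in> ?D" "s \<longlonglongrightarrow> x" for s x
    using that unfolding closure_sequential by blast
  have "cstar_subalgebra (closure ?D)"
    unfolding cstar_subalgebra_def
  proof (intro conjI ballI allI)
    show "0 \<in> closure ?D"
      using closure_subset[of ?D] rangeI[of "eval_free \<iota>" 0] by auto
    show "closed (closure ?D)" by simp
  next
    fix x y assume "x \<in> closure ?D" "y \<in> closure ?D"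
    then obtain s r where s: "\<And>n. s n \<in> ?D" "s \<longlonglongrightarrow> x" and r: "\<And>n. r n \<in> ?D" "r \<longlonglongrightarrow> y"
      using ap by metis
    show "x + y \<in> closure ?D"
    proof (rule clI)
      show "(\<lambda>n. s n + r n) \<longlonglongrightarrow> x + y" using s r by (intro tendsto_add)
      show "s n + r n \<in> ?D" for n using s(1)[of n] r(1)[of n] by (auto simp flip: eval_free_add)
    qed
    show "x * y \<in> closure ?D"
    proof (rule clI)
      show "(\<lambda>n. s n * r n) \<longlonglongrightarrow> x * y" using s r by (intro tendsto_mult)
      show "s n * r n \<in> ?D" for n using s(1)[of n] r(1)[of n] by (auto simp flip: eval_free_mult)
    qed
  next
    fix c x assume "x \<in> closure ?D"
    then obtain s where s: "\<And>n. s n \<in> ?D" "s \<longlonglongrightarrow> x" using ap by metis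
    show "c *\<^sub>C x \<in> closure ?D"
    proof (rule clI)
      show "(\<lambda>n. c *\<^sub>C s n) \<longlonglongrightarrow> c *\<^sub>C x"
        using continuous_on_tendsto_compose[OF continuous_scaleC s(2)] by simp
      show "c *\<^sub>C s n \<in> ?D" for n using s(1)[of n] by (auto simp flip: eval_free_scale)
    qed
  next
    fix x assume "x \<in> closure ?D"
    then obtain s where s: "\<And>n. s n \<in> ?D" "s \<longlonglongrightarrow> x" using ap by metis
    show "adj x \<in> closure ?D"
    proof (rule clI)
      show "(\<lambda>n. adj (s n)) \<longlonglongrightarrow> adj x"
        using continuous_on_tendsto_compose[OF continuous_adj s(2)] by simp
      show "adj (s n) \<in> ?D" for n using s(1)[of n] by (auto simp flip: eval_free_star)
    qed
  qed
  moreover have "insert 1 (range \<iota>) \<subseteq> closure ?D"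
  proof -
    have "1 \<in> ?D" using rangeI[of "eval_free \<iota>" 1] by simp
    moreover have "\<iota> x \<in> ?D" for x using rangeI[of "eval_free \<iota>" "gen x"] by simp
    ultimately have "insert 1 (range \<iota>) \<subseteq> ?D" by auto
    then show ?thesis using closure_subset by blast
  qed
  ultimately show ?thesis using assms unfolding cstar_generated_def by blast
qed

lemma eq_on_dense:
  fixes f g :: "'a::topological_space \<Rightarrow> 'b::t2_space"
  assumes "closure D = UNIV" "continuous_on UNIV f" "continuous_on UNIV g"
    and "\<And>x. x \<in> D \<Longrightarrow> f x = g x"
  shows "f x = g x"
proof -
  have "closed {x. f x = g x}" using assms(2,3) by (intro closed_Collect_eq)
  then have "closure D \<subseteq> {x. f x = g x}" using assms(4) by (intro closure_minimal) auto
  then show ?thesis using assms(1) by auto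
qed

lemma star_hom_eval:
  assumes "star_hom \<phi>" "\<phi> 1 = 1"
  shows "\<phi> (eval_free \<iota> p) = eval_free (\<phi> \<circ> \<iota>) p"
proof (induction p rule: free_induct)
  case zero
  have "\<phi> (0 *\<^sub>C 0) = 0 *\<^sub>C \<phi> 0" using assms(1) by (simp only: star_hom_def)
  then show ?case by simp
next
  case (single w c)
  have "\<phi> (prod_list (map (eval_letter \<iota>) xs)) = prod_list (map (eval_letter (\<phi> \<circ> \<iota>)) xs)" for xs
  proof (induction xs)
    case (Cons x xs)
    then show ?case using assms by (cases x) (auto simp: star_hom_def)
  qed (simp add: assms)
  then show ?case using assms(1) by (simp add: eval_free_single star_hom_def eval_word_def del: comp_apply)
next
  case (add p r)
  then show ?case using assms by (simp add: star_hom_def eval_free_add)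
qed

theorem universal_property:
  fixes \<iota> :: "'g \<Rightarrow> 'a::unital_cstar_algebra" and \<rho> :: "'g \<Rightarrow> 'b::unital_cstar_algebra"
  assumes univ: "universal_cstar_algebra R \<iota>" and rel: "satisfies_relators R \<rho>"
  shows "\<exists>!\<phi>. star_hom \<phi> \<and> \<phi> 1 = 1 \<and> continuous_on UNIV \<phi> \<and> (\<forall>x. \<phi> (\<iota> x) = \<rho> x)"
proof -
  let ?D = "range (eval_free \<iota>)"
  have dense: "closure ?D = UNIV"
    using univ dense_range_eval unfolding universal_cstar_algebra_def by blast
  have le: "norm (eval_free \<rho> p) \<le> norm (eval_free \<iota> p)" for p
    using univ rel cstar_seminorm_eval[of \<rho>]
    unfolding universal_cstar_algebra_def satisfies_relators_def by (metis norm_zero)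
  define f where "f x = eval_free \<rho> (SOME p. eval_free \<iota> p = x)" for x
  have f: "f (eval_free \<iota> p) = eval_free \<rho> p" for p
  proof -
    define r where "r = (SOME r. eval_free \<iota> r = eval_free \<iota> p)"
    have "eval_free \<iota> r = eval_free \<iota> p" unfolding r_def by (rule someI) simp
    then have "eval_free \<rho> (r - p) = 0" using le[of "r - p"] by (simp add: eval_free_diff)
    then show ?thesis by (simp add: f_def r_def[symmetric] eval_free_diff)
  qed
  have lip: "dist (f x) (f y) \<le> dist x y" if "x \<in> ?D" "y \<in> ?D" for x y
  proof -
    obtain p r where "x = eval_free \<iota> p" "y = eval_free \<iota> r" using \<open>x \<in> ?D\<close> \<open>y \<in> ?D\<close> by blast
    then show ?thesis using le[of "p - r"] by (simp add: f dist_norm eval_free_diff)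
  qed
  have "uniformly_continuous_on ?D f"
    unfolding uniformly_continuous_on_def using lip by (meson le_less_trans)
  then obtain \<phi> where uc: "uniformly_continuous_on (closure ?D) \<phi>"
    and extends: "\<And>x. x \<in> ?D \<Longrightarrow> f x = \<phi> x"
    by (metis uniformly_continuous_on_extension_on_closure)
  have cont: "continuous_on UNIV \<phi>"
    using uc dense uniformly_continuous_imp_continuous by metis
  have ev: "\<phi> (eval_free \<iota> p) = eval_free \<rho> p" for p using f extends by (metis rangeI)
  have c: "continuous_on UNIV (\<lambda>x. \<phi> (h x))" if "continuous_on UNIV h" for h :: "'a \<Rightarrow> 'a"
    using continuous_on_compose2[OF cont that] by simp
  have cadj: "continuous_on UNIV (\<lambda>x. adj (h x))" if "continuous_on UNIV h"
    for h :: "'a \<Rightarrow> 'c::unital_cstar_algebra"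
    using continuous_on_compose2[OF continuous_adj that] by simp
  have csc: "continuous_on UNIV (\<lambda>x. k *\<^sub>C (h x))" if "continuous_on UNIV h"
    for k and h :: "'a \<Rightarrow> 'c::unital_cstar_algebra"
    using continuous_on_compose2[OF continuous_scaleC that] by simp
  note cs = continuous_intros c cont cadj csc
  have add: "\<phi> (x + y) = \<phi> x + \<phi> y" for x y
  proof (rule eq_on_dense[OF dense, of "\<lambda>x. \<phi> (x + y)"])
    fix x assume x: "x \<in> ?D"
    show "\<phi> (x + y) = \<phi> x + \<phi> y"
      by (rule eq_on_dense[OF dense, of "\<lambda>y. \<phi> (x + y)"])
        (use x in \<open>auto intro!: cs simp: ev simp flip: eval_free_add\<close>)
  qed (auto intro!: cs)
  have mult: "\<phi> (x * y) = \<phi> x * \<phi> y" for x y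
  proof (rule eq_on_dense[OF dense, of "\<lambda>x. \<phi> (x * y)"])
    fix x assume x: "x \<in> ?D"
    show "\<phi> (x * y) = \<phi> x * \<phi> y"
      by (rule eq_on_dense[OF dense, of "\<lambda>y. \<phi> (x * y)"])
        (use x in \<open>auto intro!: cs simp: ev simp flip: eval_free_mult\<close>)
  qed (auto intro!: cs)
  have scale: "\<phi> (k *\<^sub>C x) = k *\<^sub>C \<phi> x" for k x
    by (rule eq_on_dense[OF dense, of "\<lambda>x. \<phi> (k *\<^sub>C x)"])
      (auto intro!: cs simp: ev simp flip: eval_free_scale)
  have star: "\<phi> (adj x) = adj (\<phi> x)" for x
    by (rule eq_on_dense[OF dense, of "\<lambda>x. \<phi> (adj x)"])
      (auto intro!: cs simp: ev simp flip: eval_free_star)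
  have one: "\<phi> 1 = 1" using ev[of 1] by simp
  have gen: "\<phi> (\<iota> x) = \<rho> x" for x using ev[of "gen x"] by simp
  show ?thesis
  proof (rule ex1I[of _ \<phi>])
    show "star_hom \<phi> \<and> \<phi> 1 = 1 \<and> continuous_on UNIV \<phi> \<and> (\<forall>x. \<phi> (\<iota> x) = \<rho> x)"
      by (simp add: star_hom_def add mult scale star one gen cont)
  next
    fix \<psi> assume \<psi>: "star_hom \<psi> \<and> \<psi> 1 = 1 \<and> continuous_on UNIV \<psi> \<and> (\<forall>x. \<psi> (\<iota> x) = \<rho> x)"
    have "\<psi> \<circ> \<iota> = \<rho>" using \<psi> by auto
    then have agree: "\<psi> (eval_free \<iota> p) = \<phi> (eval_free \<iota> p)" for p
      using star_hom_eval[of \<psi> \<iota> p] \<psi> by (simp add: ev)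
    have "\<psi> x = \<phi> x" for x
      by (rule eq_on_dense[OF dense]) (use \<psi> cont agree in auto)
    then show "\<psi> = \<phi>" by (rule ext)
  qed
qed

lemma satisfies_relators_units:
  fixes \<rho> :: "'k::finite generator \<Rightarrow> 'a::unital_cstar_algebra"
  assumes "satisfies_relators (relators m) \<rho>"
  shows "\<rho> (U 0) = 1" "\<rho> (S {#}) = 1"
proof -
  have idem: "x = 1" if "adj x * x = 1" "x * x = x" for x :: 'a
    by (metis that mult.assoc mult_1_left)
  note R = assms[unfolded satisfies_relators_iff]
  note R1 = R[THEN conjunct1, rule_format]
    and R2 = R[THEN conjunct2, THEN conjunct1, rule_format]
    and R3 = R[THEN conjunct2, THEN conjunct2, THEN conjunct1, rule_format]
    and R4 = R[THEN conjunct2, THEN conjunct2, THEN conjunct2, THEN conjunct1, rule_format]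
  show "\<rho> (U 0) = 1" by (rule idem) (use R1[of 0] R3[of 0 0] in simp_all)
  show "\<rho> (S {#}) = 1" by (rule idem) (use R2[of "{#}"] R4[of "{#}" "{#}"] in simp_all)
qed

lemma gauge_char_simps:
  assumes "t \<in> torus"
  shows "gauge_char t \<mu> {#} * gauge_char t \<nu> {#} = gauge_char t (\<mu> + \<nu>) {#}"
    and "gauge_char t \<mu> {#} * cnj (gauge_char t \<nu> {#}) = gauge_char t \<mu> \<nu>"
    and "cmod (gauge_char t \<mu> \<nu>) = 1"
    and "gauge_char (\<lambda>i. cnj (t i)) \<mu> \<nu> = cnj (gauge_char t \<mu> \<nu>)"
    and "gauge_char t {#} {#} = 1"
proof -
  have nz: "t i \<noteq> 0" and n1: "cmod (t i) = 1" for i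
    using assms by (auto simp: torus_def) (metis norm_zero zero_neq_one)
  have inv: "cnj (t i) = inverse (t i)" for i
    using n1[of i] by (metis complex_div_cnj div_by_1 inverse_eq_divide mult_1_left of_real_1 one_power2)
  show "gauge_char t \<mu> {#} * gauge_char t \<nu> {#} = gauge_char t (\<mu> + \<nu>) {#}"
    by (simp add: gauge_char_def power_int_add nz flip: prod.distrib)
  show "gauge_char t \<mu> {#} * cnj (gauge_char t \<nu> {#}) = gauge_char t \<mu> \<nu>"
    by (simp add: gauge_char_def inv nz power_int_diff power_inverse field_simps flip: prod.distrib)
  show "cmod (gauge_char t \<mu> \<nu>) = 1"
    by (simp add: gauge_char_def norm_power_int n1 flip: prod_norm)
  show "gauge_char (\<lambda>i. cnj (t i)) \<mu> \<nu> = cnj (gauge_char t \<mu> \<nu>)"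
    by (simp add: gauge_char_def)
  show "gauge_char t {#} {#} = 1" by (simp add: gauge_char_def)
qed

theorem ex1_gauge_action:
  fixes \<iota> :: "'k::finite generator \<Rightarrow> 'a::unital_cstar_algebra"
  assumes univ: "universal_cstar_algebra (relators m) \<iota>" and t: "t \<in> torus"
  shows "\<exists>!\<gamma>. star_automorphism \<gamma> \<and> continuous_on UNIV \<gamma> \<and>
     (\<forall>\<mu> g \<nu>. \<gamma> (\<iota> (S \<mu>) * \<iota> (U g) * adj (\<iota> (S \<nu>))) =
        gauge_char t \<mu> \<nu> *\<^sub>C (\<iota> (S \<mu>) * \<iota> (U g) * adj (\<iota> (S \<nu>))))" (is "\<exists>!\<gamma>. ?P \<gamma>")
proof -
  have rel: "satisfies_relators (relators m) \<iota>"
    using univ by (simp add: universal_cstar_algebra_def)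
  note R = rel[unfolded satisfies_relators_iff]
  note unit = satisfies_relators_units[OF rel]
  define \<rho> where "\<rho> s x = (case x of U g \<Rightarrow> \<iota> (U g) | S \<mu> \<Rightarrow> gauge_char s \<mu> {#} *\<^sub>C \<iota> (S \<mu>))" for s x
  have \<rho>: "satisfies_relators (relators m) (\<rho> s)" if s: "s \<in> torus" for s
  proof -
    have c1: "cnj (gauge_char s \<mu> {#}) * gauge_char s \<mu> {#} = 1" for \<mu>
      using gauge_char_simps(3)[OF s, of \<mu> "{#}"]
      by (metis complex_norm_square mult.commute of_real_1 one_power2)
    have c2: "gauge_char s \<mu> {#} * cnj (gauge_char s \<mu> {#}) = 1" for \<mu>
      using c1[of \<mu>] by (simp only: mult.commute)
    show ?thesis
      unfolding satisfies_relators_iff \<rho>_def using R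
      by (simp add: mult_scaleC_left mult_scaleC_right adj_scaleC scaleC_scaleC c1 c2 scaleC_one
          gauge_char_simps(1)[OF s] add.commute)
  qed
  have "\<exists>\<phi>. star_hom \<phi> \<and> \<phi> 1 = 1 \<and> continuous_on UNIV \<phi> \<and> (\<forall>x. \<phi> (\<iota> x) = \<rho> s x)"
    if "s \<in> torus" for s
    using universal_property[OF univ \<rho>[OF that]] by blast
  then obtain \<phi> where \<phi>: "\<And>s. s \<in> torus \<Longrightarrow>
      star_hom (\<phi> s) \<and> \<phi> s 1 = 1 \<and> continuous_on UNIV (\<phi> s) \<and> (\<forall>x. \<phi> s (\<iota> x) = \<rho> s x)"
    by metis
  have hom_id: "\<psi> = id" if "star_hom \<psi>" "\<psi> 1 = 1" "continuous_on UNIV \<psi>" "\<And>x. \<psi> (\<iota> x) = \<iota> x"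
    for \<psi> :: "'a \<Rightarrow> 'a"
  proof -
    have "star_hom (id::'a \<Rightarrow> 'a) \<and> id (1::'a) = 1 \<and> continuous_on UNIV (id::'a \<Rightarrow> 'a) \<and>
        (\<forall>x. id (\<iota> x) = \<iota> x)"
      by (simp add: star_hom_def)
    then show ?thesis using that universal_property[OF univ rel] by metis
  qed
  have comp: "\<phi> s \<circ> \<phi> s' = id" if s: "s \<in> torus" "s' \<in> torus" and s': "s' = (\<lambda>i. cnj (s i))" for s s'
  proof (rule hom_id)
    note a = \<phi>[OF s(1)] and b = \<phi>[OF s(2)]
    show "star_hom (\<phi> s \<circ> \<phi> s')" using a b by (simp add: star_hom_def)
    show "(\<phi> s \<circ> \<phi> s') 1 = 1" using a b by simp
    show "continuous_on UNIV (\<phi> s \<circ> \<phi> s')"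
      using a b by (metis continuous_on_compose continuous_on_subset subset_UNIV)
    have sc: "\<phi> s (c *\<^sub>C y) = c *\<^sub>C \<phi> s y" for c y using a by (simp add: star_hom_def)
    have c1: "cnj (gauge_char s \<mu> {#}) * gauge_char s \<mu> {#} = 1" for \<mu>
      using gauge_char_simps(3)[OF s(1), of \<mu> "{#}"]
      by (metis complex_norm_square mult.commute of_real_1 one_power2)
    show "(\<phi> s \<circ> \<phi> s') (\<iota> x) = \<iota> x" for x
      using a b
      by (cases x) (simp_all add: \<rho>_def sc s' gauge_char_simps(4)[OF s(1)] scaleC_scaleC c1 scaleC_one)
  qed
  define t' where "t' = (\<lambda>i. cnj (t i))"
  have t': "t' \<in> torus" "t = (\<lambda>i. cnj (t' i))" using t by (auto simp: torus_def t'_def)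
  have bij: "bij (\<phi> t)"
    using comp[OF t t'(1) t'_def] comp[OF t'(1) t t'(2)] by (metis o_bij)
  have P: "?P (\<phi> t)"
    using \<phi>[OF t] bij
    by (simp add: star_automorphism_def star_hom_def \<rho>_def mult_scaleC_left mult_scaleC_right
        adj_scaleC scaleC_scaleC gauge_char_simps(2)[OF t] mult.commute[of "cnj _"])
  show ?thesis
  proof (rule ex1I[of _ "\<phi> t"])
    show "?P (\<phi> t)" by (rule P)
  next
    fix \<gamma> assume g: "?P \<gamma>"
    then have F: "\<gamma> (\<iota> (S \<mu>) * \<iota> (U g) * adj (\<iota> (S \<nu>))) =
        gauge_char t \<mu> \<nu> *\<^sub>C (\<iota> (S \<mu>) * \<iota> (U g) * adj (\<iota> (S \<nu>)))" for \<mu> g \<nu> by blast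
    have one: "\<gamma> 1 = 1"
      using F[of "{#}" 0 "{#}"] by (simp add: unit gauge_char_simps(5)[OF t] scaleC_one)
    have "\<gamma> (\<iota> x) = \<rho> t x" for x
    proof (cases x)
      case (U g)
      then show ?thesis
        using F[of "{#}" g "{#}"] by (simp add: unit gauge_char_simps(5)[OF t] scaleC_one \<rho>_def)
    next
      case (S \<mu>)
      then show ?thesis using F[of \<mu> 0 "{#}"] by (simp add: unit \<rho>_def)
    qed
    moreover have "star_hom \<gamma>" "continuous_on UNIV \<gamma>" using g by (auto simp: star_automorphism_def)
    ultimately show "\<gamma> = \<phi> t"
      using one \<phi>[OF t] universal_property[OF univ \<rho>[OF t]] by metis
  qed
qed

end

theory Submission
  imports Defs
begin

text \<open>The algebra is \<open>C*(G)\<close> for \<open>G = N \<rtimes> \<int>\<^sup>k\<close>, where \<open>N = \<int>[1/m\<^sub>1, \<dots>, 1/m\<^sub>k]\<close> and \<open>p \<in> \<int>\<^sup>k\<close> acts as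
  multiplication by \<open>m\<^sup>-\<^sup>p\<close>. As \<open>N\<close> and \<open>\<int>\<^sup>k\<close> are abelian, hence of polynomial growth, comparing the
  norms of high powers of \<open>x* x\<close> shows that the universal norm is the norm of the regular
  representation. So elements are determined by their Fourier coefficients, and cutting these down
  to the abelian subgroup \<open>H = N \<times> {p. m\<^sup>p = 1}\<close> is a faithful conditional expectation onto \<open>C*(H)\<close>.
  Fixed points of the gauge action are supported on \<open>N \<subseteq> H\<close>, so \<open>C*(H)\<close> commutes with them.
  Conversely, an element commuting with \<open>u\<^sub>a\<close> has coefficients that are constant on the orbits of
  conjugation by \<open>a\<close>, and these are infinite outside \<open>H\<close>, so square summability puts
  it in \<open>C*(H)\<close>. Thus \<open>F' = C*(H)\<close>, and \<open>C*(H)\<close> is normalised by all generators.\<close>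

section \<open>Positivity and growth\<close>

text \<open>The splitting into \<open>N\<close> and the degrees is forced: the group as a whole can
  have exponential growth (one colour with weight 2 gives the Baumslag-Solitar group BS(1,2)), so
  the supports of high powers cannot be counted in one go. A component of fixed degree is translated
  into \<open>N\<close> and bounded there, after which only the number of degrees remains to be
  counted.

  The two inequalities between the norms have different sources. The regular representation gives a
  C*-seminorm that kills the relators, so by maximality it lies below the universal norm; the growth
  argument gives the reverse bound. Both are carried out on the free *-algebra, with words standing
  for group elements.

  \<open>H\<close> is the centraliser of \<open>a\<close>: conjugation by \<open>a\<close> turns the
  map with scale \<open>q\<close> and translation \<open>n\<close> into the one with scale
  \<open>q\<close> and translation \<open>n + 1 - q\<close>. \<open>H\<close> can be larger than
  \<open>N\<close>, because the weights may be multiplicatively dependent or equal to 1 or -1; this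
  is why the expectation cuts along the scale and not along the degree.\<close>

lemma adj_scaleR: "adj (r *\<^sub>R x) = r *\<^sub>R adj (x::'a::unital_cstar_algebra)"
  by (simp add: scaleR_scaleC adj_scaleC)

lemma tendsto_adj: "(f \<longlongrightarrow> l) F \<Longrightarrow> ((\<lambda>x. adj (f x)) \<longlongrightarrow> adj (l::'a::unital_cstar_algebra)) F"
  using continuous_on_tendsto_compose[OF continuous_adj] by simp

text \<open>The iteration converges to \<open>1 - sqrt (1 - z)\<close> for \<open>norm z \<le> 1\<close>: all coefficients of the iterates
  as polynomials in \<open>z\<close> are nonnegative, so the increments are dominated by those for \<open>z = 1\<close>. This
  yields square roots without functional calculus.\<close>

primrec sqrt_iter :: "'a::real_algebra_1 \<Rightarrow> nat \<Rightarrow> 'a" where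
  "sqrt_iter z 0 = 0"
| "sqrt_iter z (Suc n) = (1/2) *\<^sub>R (z + sqrt_iter z n * sqrt_iter z n)"

lemma sqrt_iter_commute:
  assumes "c * z = z * c"
  shows "c * sqrt_iter z n = sqrt_iter z n * c"
proof (induction n)
  case (Suc n)
  have "c * (sqrt_iter z n * sqrt_iter z n) = sqrt_iter z n * sqrt_iter z n * c"
    by (metis Suc mult.assoc)
  then show ?case using assms by (simp add: algebra_simps)
qed simp

lemma sqrt_iter_one: "sqrt_iter (1::real) n \<le> sqrt_iter 1 (Suc n) \<and> 0 \<le> sqrt_iter (1::real) n \<and>
    sqrt_iter (1::real) n \<le> 1"
proof (induction n)
  case (Suc n)
  then have "sqrt_iter (1::real) n * sqrt_iter 1 n \<le> sqrt_iter 1 (Suc n) * sqrt_iter 1 (Suc n)"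
    by (intro mult_mono) auto
  moreover have "sqrt_iter (1::real) n * sqrt_iter 1 n \<le> 1"
    using Suc by (intro mult_le_one) auto
  ultimately show ?case using Suc by auto
qed simp

lemma norm_sqrt_iter:
  fixes z :: "'a::real_normed_algebra_1"
  assumes "norm z \<le> 1"
  shows "norm (sqrt_iter z n) \<le> sqrt_iter 1 n"
proof (induction n)
  case (Suc n)
  have "norm (sqrt_iter z n * sqrt_iter z n) \<le> sqrt_iter 1 n * sqrt_iter 1 n"
    using Suc sqrt_iter_one[of n] norm_mult_ineq[of "sqrt_iter z n" "sqrt_iter z n"]
    by (meson mult_mono norm_ge_zero order_trans)
  then show ?case using assms norm_triangle_ineq[of z "sqrt_iter z n * sqrt_iter z n"] by simp
qed simp

text \<open>One factorisation serves both the algebra and its real majorant; consecutive iterates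
  commute, so the difference of squares factors.\<close>

lemma half_square_diff:
  fixes x y z :: "'a::real_algebra_1"
  assumes w: "w = (1/2) *\<^sub>R (z + y * y)" and y: "y = (1/2) *\<^sub>R (z + x * x)" and "y * x = x * y"
  shows "w - y = (1/2) *\<^sub>R ((y - x) * (y + x))"
proof -
  have "w - y = (1/2) *\<^sub>R (z + y * y) - (1/2) *\<^sub>R (z + x * x)" using w y by metis
  also have "\<dots> = (1/2) *\<^sub>R (y * y - x * x)" by (simp add: algebra_simps)
  also have "y * y - x * x = (y - x) * (y + x)" using assms(3) by (simp add: algebra_simps)
  finally show ?thesis .
qed

lemma norm_sqrt_iter_step:
  fixes z :: "'a::real_normed_algebra_1"
  assumes "norm z \<le> 1"
  shows "norm (sqrt_iter z (Suc n) - sqrt_iter z n) \<le> sqrt_iter 1 (Suc n) - sqrt_iter 1 n"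
proof (induction n)
  case 0
  then show ?case using assms by simp
next
  case (Suc n)
  let ?y = "sqrt_iter z" and ?t = "sqrt_iter (1::real)"
  have "?y (Suc n) * ?y n = ?y n * ?y (Suc n)"
    using sqrt_iter_commute[of _ z] by metis
  then have "?y (Suc (Suc n)) - ?y (Suc n) = (1/2) *\<^sub>R ((?y (Suc n) - ?y n) * (?y (Suc n) + ?y n))"
    by (rule half_square_diff[OF sqrt_iter.simps(2) sqrt_iter.simps(2)])
  moreover have "norm ((?y (Suc n) - ?y n) * (?y (Suc n) + ?y n)) \<le>
      (?t (Suc n) - ?t n) * (?t (Suc n) + ?t n)"
  proof (rule order_trans[OF norm_mult_ineq mult_mono[OF Suc]])
    show "norm (?y (Suc n) + ?y n) \<le> ?t (Suc n) + ?t n"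
      using norm_sqrt_iter[OF assms] by (intro norm_triangle_mono)
    show "0 \<le> ?t (Suc n) - ?t n" using sqrt_iter_one[of n] by linarith
  qed simp
  moreover have "?t (Suc (Suc n)) - ?t (Suc n) = (1/2) *\<^sub>R ((?t (Suc n) - ?t n) * (?t (Suc n) + ?t n))"
    by (rule half_square_diff[OF sqrt_iter.simps(2) sqrt_iter.simps(2)]) (rule mult.commute)
  ultimately show ?case by (simp del: sqrt_iter.simps)
qed

lemma convergent_sqrt_iter:
  fixes z :: "'a::{banach,real_normed_algebra_1}"
  assumes "norm z \<le> 1"
  shows "convergent (sqrt_iter z)"
proof -
  have le: "norm (sqrt_iter z (n + k) - sqrt_iter z n) \<le> sqrt_iter 1 (n + k) - sqrt_iter 1 n" for n k
  proof (induction k)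
    case (Suc k)
    have "sqrt_iter z (n + Suc k) - sqrt_iter z n =
        (sqrt_iter z (Suc (n + k)) - sqrt_iter z (n + k)) + (sqrt_iter z (n + k) - sqrt_iter z n)"
      by simp
    then have "norm (sqrt_iter z (n + Suc k) - sqrt_iter z n) \<le>
        norm (sqrt_iter z (Suc (n + k)) - sqrt_iter z (n + k)) + norm (sqrt_iter z (n + k) - sqrt_iter z n)"
      by (metis norm_triangle_ineq)
    with Suc norm_sqrt_iter_step[OF assms, of "n + k"] show ?case by simp
  qed simp
  have "incseq (sqrt_iter (1::real))" using sqrt_iter_one by (intro incseq_SucI) blast
  moreover have "Bseq (sqrt_iter (1::real))"
    using sqrt_iter_one by (intro BseqI'[of _ 1]) (auto simp: abs_le_iff intro: order_trans[of _ 0])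
  ultimately have "Cauchy (sqrt_iter (1::real))"
    by (simp add: Bseq_monoseq_convergent Cauchy_convergent_iff monoseq_iff)
  have "Cauchy (sqrt_iter z)"
  proof (rule CauchyI')
    fix e :: real assume "e > 0"
    then obtain M where M: "\<And>m n. m \<ge> M \<Longrightarrow> n \<ge> M \<Longrightarrow> norm (sqrt_iter (1::real) m - sqrt_iter 1 n) < e"
      using CauchyD[OF \<open>Cauchy (sqrt_iter (1::real))\<close>] by blast
    show "\<exists>M. \<forall>m\<ge>M. \<forall>n>m. dist (sqrt_iter z m) (sqrt_iter z n) < e"
    proof (intro exI[of _ M] allI impI)
      fix m n assume "m \<ge> M" "n > m"
      then show "dist (sqrt_iter z m) (sqrt_iter z n) < e"
        using le[of m "n - m"] M[of n m] by (simp add: dist_norm norm_minus_commute)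
    qed
  qed
  then show ?thesis by (simp add: Cauchy_convergent_iff)
qed

text \<open>For \<open>z = 1 - b\<close> the limit \<open>y\<close> of the iteration satisfies
  \<open>2 y = z + y^2\<close>, that is \<open>(1 - y)^2 = b\<close>. All iterates are self-adjoint,
  hence so is \<open>1 - y\<close>.\<close>

lemma positive_near_one:
  fixes b :: "'a::unital_cstar_algebra"
  assumes "adj b = b" "norm (1 - b) \<le> 1"
  shows "positive b"
proof -
  define z where "z = 1 - b"
  obtain y where y: "sqrt_iter z \<longlonglongrightarrow> y"
    using convergent_sqrt_iter[of z] assms(2) by (auto simp: z_def convergent_def)
  have "(\<lambda>n. sqrt_iter z (Suc n)) \<longlonglongrightarrow> (1/2) *\<^sub>R (z + y * y)"
    unfolding sqrt_iter.simps by (intro tendsto_intros y)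
  then have "y = (1/2) *\<^sub>R (z + y * y)" using LIMSEQ_Suc[OF y] LIMSEQ_unique by blast
  then have "2 *\<^sub>R y = 2 *\<^sub>R (1/2) *\<^sub>R (z + y * y)" by simp
  then have "2 *\<^sub>R y = z + y * y" by simp
  then have "(1 - y) * (1 - y) = b" by (simp add: algebra_simps z_def scaleR_2)
  moreover have "adj (sqrt_iter z n) = sqrt_iter z n" for n
    by (induction n) (simp_all add: adj_scaleR adj_add adj_mult z_def adj_diff assms(1))
  then have "sqrt_iter z \<longlonglongrightarrow> adj y" using tendsto_adj[OF y] by simp
  then have "adj y = y" using y by (rule LIMSEQ_unique)
  then have "adj (1 - y) = 1 - y" by (simp add: adj_diff)
  ultimately show ?thesis unfolding positive_def by metis
qed

lemma positive_scaleR: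
  assumes "positive b" "r \<ge> 0"
  shows "positive (r *\<^sub>R b)"
proof -
  obtain x where "b = adj x * x" using assms(1) by (auto simp: positive_def)
  then have "r *\<^sub>R b = adj (sqrt r *\<^sub>R x) * (sqrt r *\<^sub>R x)" using assms(2) by (simp add: adj_scaleR)
  then show ?thesis unfolding positive_def by blast
qed

text \<open>Scaling by \<open>1/c\<close> reduces this to the unit ball around 1; for
  \<open>c = 0\<close> the bound leaves only \<open>b = 0\<close>.\<close>

lemma positive_if_norm_diff_le:
  fixes b :: "'a::unital_cstar_algebra"
  assumes "adj b = b" "norm (c *\<^sub>R 1 - b) \<le> c" 
  shows "positive b"
proof (cases "c = 0")
  case True
  then show ?thesis using assms by (auto simp: positive_def intro!: exI[of _ 0])
next
  case False
  then have c: "c > 0" using assms(2) norm_ge_zero[of "c *\<^sub>R 1 - b"] by linarith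
  have "1 - (1/c) *\<^sub>R b = (1/c) *\<^sub>R (c *\<^sub>R 1 - b)" using c by (simp add: scaleR_diff_right)
  then have "norm (1 - (1/c) *\<^sub>R b) \<le> 1" using assms(2) c by simp
  then have "positive ((1/c) *\<^sub>R b)" using assms(1) by (intro positive_near_one) (simp_all add: adj_scaleR)
  then have "positive (c *\<^sub>R (1/c) *\<^sub>R b)" using c by (rule positive_scaleR[OF _ less_imp_le])
  moreover have "c *\<^sub>R (1/c) *\<^sub>R b = b" using c by simp
  ultimately show ?thesis by (simp only:)
qed

section \<open>Dyadic powers and polynomial growth\<close>

text \<open>If \<open>a > b > 0\<close>, the \<open>k\<close>-th root \<open>d\<close> of the ratio
  exceeds 1 and satisfies \<open>d ^ (2 ^ n) \<le> 2 ^ n + 1\<close>, so an exponential would stay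
  below a linear function.\<close>

lemma le_if_power_le_poly:
  fixes a b :: real
  assumes "b \<ge> 0" and le: "\<And>n. a ^ (2 ^ n) \<le> real (2 ^ n + 1) ^ k * b ^ (2 ^ n)"
  shows "a \<le> b"
proof (rule ccontr)
  assume "\<not> a \<le> b"
  show False
  proof (cases "b = 0")
    case True
    then show False using le[of 0] \<open>\<not> a \<le> b\<close> by simp
  next
    case False
    define c where "c = a / b"
    have b: "b > 0" using False assms(1) by simp
    have c: "c > 1" using \<open>\<not> a \<le> b\<close> b by (simp add: c_def)
    have le': "c ^ (2 ^ n) \<le> real (2 ^ n + 1) ^ k" for n
      using le[of n] b by (simp add: c_def power_divide divide_le_eq)
    have k: "k > 0" using le'[of 0] c by (cases k) auto
    define d where "d = root k c"
    have d: "d > 1" "d ^ k = c" using c k by (auto simp: d_def)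
    have le_d: "d ^ (2 ^ n) \<le> 2 ^ n + 1" for n
    proof -
      have "(d ^ (2 ^ n)) ^ k \<le> (2 ^ n + 1) ^ k"
        using le'[of n] by (simp add: add.commute flip: d(2) power_mult add: mult.commute)
      then show ?thesis using k d(1) by (simp add: power_mono_iff)
    qed
    have "(\<lambda>n. of_nat n / d ^ n) \<longlonglongrightarrow> (0::real)" using d(1) by (intro lim_n_over_pown) simp
    then have "\<forall>\<^sub>F n in sequentially. real n / d ^ n < 1 / 2"
      by (rule order_tendstoD) simp
    then obtain N where N: "\<And>n. n \<ge> N \<Longrightarrow> real n / d ^ n < 1 / 2"
      by (auto simp: eventually_sequentially)
    \<comment> \<open>The limit is read off at the index \<open>2 ^ N\<close>, beyond
      \<open>N\<close>, to make the exponent dyadic. The threshold 1/2 gives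
      \<open>d ^ (2 ^ N) > 2 * 2 ^ N\<close>, which is at least \<open>2 ^ N + 1\<close>.\<close>
    have "real (2 ^ N) / d ^ (2 ^ N) < 1 / 2" by (rule N) (rule less_imp_le, rule less_exp)
    then have "2 * 2 ^ N < d ^ (2 ^ N)" using d(1) by (simp add: divide_less_eq)
    moreover have "(2::real) ^ N \<ge> 1" by simp
    ultimately show False using le_d[of N] by linarith
  qed
qed

text \<open>The C*-identity for the self-adjoint \<open>x ^ 2 ^ n\<close> doubles the exponent at
  each step; hence the growth arguments run along dyadic powers.\<close>

lemma norm_power_self_adjoint:
  fixes x :: "'a::unital_cstar_algebra"
  assumes "adj x = x"
  shows "norm (x ^ 2 ^ n) = norm x ^ 2 ^ n"
proof (induction n)
  case (Suc n)
  have adj: "adj (x ^ k) = x ^ k" for k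
    by (induction k) (simp_all add: adj_mult assms power_commutes)
  have "x ^ 2 ^ Suc n = adj (x ^ 2 ^ n) * x ^ 2 ^ n"
    by (simp add: adj power_mult power2_eq_square mult.commute[of 2])
  then show ?case
    by (simp add: norm_adj_mult Suc power_mult mult.commute[of 2])
qed simp

text \<open>A word occurring in \<open>x ^ n\<close> is a concatenation of \<open>n\<close> words of
  \<open>x\<close>. Since \<open>\<delta>\<close> takes values in a commutative monoid, it sees only
  the multiset of the factors. Additivity is asked on \<open>Z\<close> alone, because translation
  parts add only where the scale is 1.\<close>

lemma sum_mset_of_power_keys:
  fixes x :: "'w::monoid_add \<Rightarrow>\<^sub>0 'c::comm_semiring_1" and \<delta> :: "'w \<Rightarrow> 'd::comm_monoid_add"
  assumes Z: "0 \<in> Z" "\<And>v w. v \<in> Z \<Longrightarrow> w \<in> Z \<Longrightarrow> v + w \<in> Z"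
    and \<delta>: "\<delta> 0 = 0" "\<And>v w. v \<in> Z \<Longrightarrow> w \<in> Z \<Longrightarrow> \<delta> (v + w) = \<delta> v + \<delta> w"
    and x: "Poly_Mapping.keys x \<subseteq> Z"
    and w: "w \<in> Poly_Mapping.keys (x ^ n)"
  shows "w \<in> Z \<and> (\<exists>M. set_mset M \<subseteq> Poly_Mapping.keys x \<and> size M = n \<and> \<delta> w = (\<Sum>t\<in>#M. \<delta> t))"
  using w
proof (induction n arbitrary: w)
  case 0
  then have "w = 0" by (auto split: if_splits simp flip: single_one)
  then show ?case using Z \<delta> by simp
next
  case (Suc n)
  obtain a b where ab: "w = a + b" "a \<in> Poly_Mapping.keys x" "b \<in> Poly_Mapping.keys (x ^ n)"
    using Suc.prems keys_mult[of x "x ^ n"] by auto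
  obtain M where M: "b \<in> Z" "set_mset M \<subseteq> Poly_Mapping.keys x" "size M = n" "\<delta> b = (\<Sum>t\<in>#M. \<delta> t)"
    using Suc.IH[OF ab(3)] by blast
  then show ?case using ab x Z \<delta> by (auto intro!: exI[of _ "add_mset a M"])
qed

text \<open>A multiset over \<open>T\<close> is encoded by its multiplicities, each at most
  \<open>n\<close>. The crude count suffices because only its polynomial dependence on
  \<open>n\<close> enters.\<close>

lemma card_multisets_le:
  assumes "finite T"
  shows "finite {M. set_mset M \<subseteq> T \<and> size M = n} \<and>
    card {M. set_mset M \<subseteq> T \<and> size M = n} \<le> (n + 1) ^ card T"
proof -
  let ?A = "{M. set_mset M \<subseteq> T \<and> size M = n}" and ?B = "T \<rightarrow>\<^sub>E {..n}"
  have inj: "inj_on (\<lambda>M. restrict (count M) T) ?A"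
  proof (rule inj_onI, rule multiset_eqI)
    fix M M' :: "'a multiset" and x assume *: "M \<in> ?A" "M' \<in> ?A" "restrict (count M) T = restrict (count M') T"
    show "count M x = count M' x"
    proof (cases "x \<in> T")
      case True
      then show ?thesis using fun_cong[OF *(3), of x] by simp
    next
      case False
      then have "x \<notin># M" "x \<notin># M'" using * by auto
      then show ?thesis by (simp add: not_in_iff)
    qed
  qed
  have sub: "(\<lambda>M. restrict (count M) T) ` ?A \<subseteq> ?B"
    by (auto simp: count_le_size)
  have B: "finite ?B" "card ?B = (n + 1) ^ card T"
    using assms by (simp_all add: finite_PiE card_PiE)
  show ?thesis using card_inj_on_le[OF inj sub B(1)] inj_on_finite[OF inj sub B(1)] B(2) by simp
qed

lemma card_image_keys_power_le:
  fixes x :: "'w::monoid_add \<Rightarrow>\<^sub>0 'c::comm_semiring_1" and \<delta> :: "'w \<Rightarrow> 'd::comm_monoid_add"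
  assumes "0 \<in> Z" "\<And>v w. v \<in> Z \<Longrightarrow> w \<in> Z \<Longrightarrow> v + w \<in> Z"
    and "\<delta> 0 = 0" "\<And>v w. v \<in> Z \<Longrightarrow> w \<in> Z \<Longrightarrow> \<delta> (v + w) = \<delta> v + \<delta> w"
    and "Poly_Mapping.keys x \<subseteq> Z"
  shows "card (\<delta> ` Poly_Mapping.keys (x ^ n)) \<le> (n + 1) ^ card (Poly_Mapping.keys x)"
proof -
  let ?A = "{M. set_mset M \<subseteq> Poly_Mapping.keys x \<and> size M = n}"
  have "\<delta> ` Poly_Mapping.keys (x ^ n) \<subseteq> (\<lambda>M. \<Sum>t\<in>#M. \<delta> t) ` ?A"
    using sum_mset_of_power_keys[of Z \<delta> x _ n] assms by blast
  moreover note card_multisets_le[OF finite_keys, of x n]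
  ultimately show ?thesis
    by (meson card_image_le card_mono finite_imageI order_trans)
qed


section \<open>Reduced C*-seminorms on the free *-algebra\<close>

text \<open>Additive notation for a group that is in general not commutative; a star becomes
  inversion, so unitarity of the generators is built in.\<close>

fun letter_val :: "('g \<Rightarrow> 'b::group_add) \<Rightarrow> 'g letter \<Rightarrow> 'b" where
  "letter_val h (Plain x) = h x"
| "letter_val h (Starred x) = - h x"

definition word_val :: "('g \<Rightarrow> 'b::group_add) \<Rightarrow> 'g word \<Rightarrow> 'b" where
  "word_val h w = sum_list (map (letter_val h) (letters w))"

lemma word_val_zero [simp]: "word_val h 0 = 0"
  by (simp add: word_val_def zero_word_def)

lemma word_val_plus [simp]: "word_val h (v + w) = word_val h v + word_val h w"
  by (simp add: word_val_def plus_word_def)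

lemma word_val_star [simp]: "word_val h (star_word w) = - word_val h w"
proof -
  have l: "letter_val h (star_letter x) = - letter_val h x" for x by (cases x) auto
  have "sum_list (map (letter_val h) (rev (map star_letter xs))) = - sum_list (map (letter_val h) xs)" for xs
    by (induction xs) (simp_all add: l minus_add)
  then show ?thesis by (simp add: word_val_def star_word_def)
qed

lemma star_word_zero [simp]: "star_word 0 = 0"
  by (simp add: star_word_def zero_word_def)

lemma star_word_plus: "star_word (v + w) = star_word w + star_word v"
  by (simp add: star_word_def plus_word_def)

lemma star_free_mult: "star_free (p * r) = star_free r * star_free p"
proof (induction p rule: free_induct)
  case (single w c)
  show ?case
  proof (induction r rule: free_induct)
    case (single v d)
    then show ?case by (simp add: mult_single star_free_single star_word_plus mult.commute)
  qed (auto simp: distrib_left distrib_right star_free_add)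
qed (auto simp: distrib_left distrib_right star_free_add)

lemma star_free_star [simp]: "star_free (star_free p) = p"
  by (induction p rule: free_induct) (auto simp: star_free_single star_free_add)

lemma star_free_one [simp]: "star_free 1 = 1"
  by (simp add: star_free_single flip: single_one)

lemma scale_free_single: "scale_free c (Poly_Mapping.single w d) = Poly_Mapping.single w (c * d)"
  by (simp add: scale_free_def mult_single)

lemma scale_free_add: "scale_free c (p + r) = scale_free c p + scale_free c r"
  by (simp add: scale_free_def distrib_left)

lemma scale_free_diff: "scale_free c (p - r) = scale_free c p - scale_free c r"
  by (simp add: scale_free_def right_diff_distrib)

lemma scale_free_zero [simp]: "scale_free c 0 = 0"
  by (simp add: scale_free_def)

lemma star_free_scale: "star_free (scale_free c p) = scale_free (cnj c) (star_free p)"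
  by (induction p rule: free_induct)
    (auto simp: scale_free_single star_free_single star_free_add scale_free_add)

lemma scale_free_mult_left: "scale_free c p * r = scale_free c (p * r)"
  by (simp add: scale_free_def mult.assoc)

lemma scale_free_mult_right: "p * scale_free c r = scale_free c (p * r)"
proof (induction p rule: free_induct)
  case (single w d)
  show ?case
  proof (induction r rule: free_induct)
    case (single v e)
    then show ?case by (simp add: mult_single scale_free_single mult.left_commute)
  qed (auto simp: distrib_left scale_free_def)
qed (auto simp: distrib_right distrib_left scale_free_add scale_free_def)

lemma scale_free_scale_free: "scale_free c (scale_free d p) = scale_free (c * d) p"
  by (simp add: scale_free_def mult_single flip: mult.assoc)

lemma scale_free_one [simp]: "scale_free 1 p = p"
  by (simp add: scale_free_def)

section \<open>Group algebra coefficients and the l2 seminorm\<close>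

text \<open>The coefficient at \<open>g\<close> of the image of \<open>p\<close> in the group
  algebra. Words with the same value are merged, which is where the relations of the group
  enter.\<close>

definition coef :: "('g \<Rightarrow> 'b::group_add) \<Rightarrow> 'b \<Rightarrow> 'g free_star_algebra \<Rightarrow> complex" where
  "coef h g p = (\<Sum>w\<in>Poly_Mapping.keys p. if word_val h w = g then Poly_Mapping.lookup p w else 0)"

abbreviation supp :: "('g \<Rightarrow> 'b::group_add) \<Rightarrow> 'g free_star_algebra \<Rightarrow> 'b set" where
  "supp h p \<equiv> word_val h ` Poly_Mapping.keys p"

lemma coef_superset:
  assumes "finite A" "Poly_Mapping.keys p \<subseteq> A"
  shows "coef h g p = (\<Sum>w\<in>A. if word_val h w = g then Poly_Mapping.lookup p w else 0)"
  unfolding coef_def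
  by (rule sum.mono_neutral_left) (use assms in \<open>auto simp: in_keys_iff\<close>)

lemma coef_add: "coef h g (p + r) = coef h g p + coef h g r"
proof -
  let ?A = "Poly_Mapping.keys p \<union> Poly_Mapping.keys r"
  have f: "finite ?A" by simp
  show ?thesis
    using coef_superset[OF f, of "p + r" h g] coef_superset[OF f, of p h g]
      coef_superset[OF f, of r h g] Poly_Mapping.keys_add[of p r]
    by (simp add: lookup_add sum.distrib flip: sum.distrib cong: if_cong)
      (rule sum.cong, auto simp: lookup_add)
qed

lemma coef_single: "coef h g (Poly_Mapping.single w c) = (if word_val h w = g then c else 0)"
  by (simp add: coef_def)

lemma coef_zero [simp]: "coef h g 0 = 0"
  by (simp add: coef_def)

lemma coef_one: "coef h g 1 = (if g = 0 then 1 else 0)"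
  using coef_single[of h g 0 1] by auto

lemma coef_minus: "coef h g (- p) = - coef h g p"
  using coef_add[of h g p "-p"] by (simp add: eq_neg_iff_add_eq_0 add.commute)

lemma coef_diff: "coef h g (p - r) = coef h g p - coef h g r"
  using coef_add[of h g p "-r"] by (simp add: coef_minus)

lemma coef_eq_zero: "g \<notin> supp h p \<Longrightarrow> coef h g p = 0"
  by (auto simp: coef_def intro!: sum.neutral)

lemma coef_single_mult:
  "coef h g (Poly_Mapping.single w c * p) = c * coef h (- word_val h w + g) p"
proof (induction p rule: free_induct)
  case (single v d)
  have "word_val h w + word_val h v = g \<longleftrightarrow> word_val h v = - word_val h w + g"
    by auto
  then show ?case by (simp add: mult_single coef_single)
qed (auto simp: distrib_left coef_add)

lemma coef_mult_single:
  "coef h g (p * Poly_Mapping.single w c) = coef h (g - word_val h w) p * c"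
proof (induction p rule: free_induct)
  case (single v d)
  have "word_val h v + word_val h w = g \<longleftrightarrow> word_val h v = g - word_val h w"
    by auto
  then show ?case by (simp add: mult_single coef_single)
qed (auto simp: distrib_right coef_add)

lemma coef_scale: "coef h g (scale_free c p) = c * coef h g p"
  by (simp add: scale_free_def coef_single_mult)

text \<open>\<open>coef h 0\<close> is the canonical trace, and the trace of p* q is the l2 inner
  product of the coefficient families. The index set may be any finite set containing the support of
  \<open>q\<close>, so that two elements can share one.\<close>

lemma coef_inner:
  assumes "finite A" "supp h q \<subseteq> A"
  shows "coef h 0 (star_free p * q) = (\<Sum>g\<in>A. cnj (coef h g p) * coef h g q)"
proof (induction p rule: free_induct)
  case (single w c)
  have "(\<Sum>g\<in>A. cnj (coef h g (Poly_Mapping.single w c)) * coef h g q) =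
      (\<Sum>g\<in>A. if g = word_val h w then cnj c * coef h g q else 0)"
    by (rule sum.cong) (auto simp: coef_single)
  also have "\<dots> = cnj c * coef h (word_val h w) q"
    using assms coef_eq_zero[of "word_val h w" h q] by (auto simp: sum.delta')
  finally show ?case by (simp add: star_free_single coef_single_mult)
qed (auto simp: star_free_add coef_add distrib_left distrib_right sum.distrib)

definition coef_norm :: "('g \<Rightarrow> 'b::group_add) \<Rightarrow> 'g free_star_algebra \<Rightarrow> real" where
  "coef_norm h p = L2_set (\<lambda>g. cmod (coef h g p)) (supp h p)"

lemma coef_norm_superset:
  assumes "finite A" "supp h p \<subseteq> A"
  shows "coef_norm h p = L2_set (\<lambda>g. cmod (coef h g p)) A"
  unfolding coef_norm_def L2_set_def
  by (rule arg_cong[of _ _ sqrt], rule sum.mono_neutral_left)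
    (use assms coef_eq_zero[of _ h p] in auto)

lemma coef_norm_power2: "(coef_norm h p)\<^sup>2 = Re (coef h 0 (star_free p * p))"
proof -
  have "cnj z * z = complex_of_real ((cmod z)\<^sup>2)" for z
    by (metis complex_norm_square mult.commute)
  then show ?thesis
    by (subst coef_inner[of "supp h p"]) (simp_all add: coef_norm_def L2_set_def sum_nonneg)
qed

lemma coef_norm_nonneg [simp]: "coef_norm h p \<ge> 0"
  by (simp add: coef_norm_def L2_set_nonneg)

lemma coef_norm_le_cmod: "cmod (coef h g p) \<le> coef_norm h p"
proof -
  have "cmod (coef h g p) \<le> L2_set (\<lambda>g. cmod (coef h g p)) (insert g (supp h p))"
    by (rule member_le_L2_set) auto
  also have "\<dots> = coef_norm h p" by (rule coef_norm_superset[symmetric]) auto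
  finally show ?thesis .
qed

lemma coef_norm_mono:
  assumes "\<And>g. cmod (coef h g p) \<le> cmod (coef h g q)"
  shows "coef_norm h p \<le> coef_norm h q"
proof -
  let ?A = "supp h p \<union> supp h q"
  show ?thesis
    using assms coef_norm_superset[of ?A h p] coef_norm_superset[of ?A h q]
    by (auto intro!: L2_set_mono)
qed

lemma coef_norm_cong: "(\<And>g. coef h g p = coef h g q) \<Longrightarrow> coef_norm h p = coef_norm h q"
  by (intro antisym coef_norm_mono) auto

lemma sum_cmod_coef_le: "finite A \<Longrightarrow> (\<Sum>g\<in>A. (cmod (coef h g p))\<^sup>2) \<le> (coef_norm h p)\<^sup>2"
proof -
  assume "finite A"
  then have "(coef_norm h p)\<^sup>2 = (\<Sum>g\<in>A \<union> supp h p. (cmod (coef h g p))\<^sup>2)"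
    by (subst coef_norm_superset[of "A \<union> supp h p"]) (auto simp: L2_set_def sum_nonneg)
  also have "\<dots> \<ge> (\<Sum>g\<in>A. (cmod (coef h g p))\<^sup>2)" using \<open>finite A\<close> by (intro sum_mono2) auto
  finally show ?thesis .
qed

lemma coef_norm_triangle: "coef_norm h (p + q) \<le> coef_norm h p + coef_norm h q"
proof -
  let ?A = "supp h p \<union> supp h q"
  have "supp h (p + q) \<subseteq> ?A" using Poly_Mapping.keys_add[of p q] by blast
  then have "coef_norm h (p + q) = L2_set (\<lambda>g. cmod (coef h g p + coef h g q)) ?A"
    using coef_norm_superset[of ?A h "p + q"] by (simp add: coef_add)
  also have "\<dots> \<le> L2_set (\<lambda>g. cmod (coef h g p) + cmod (coef h g q)) ?A"
    by (intro L2_set_mono norm_triangle_ineq) simp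
  also have "\<dots> \<le> L2_set (\<lambda>g. cmod (coef h g p)) ?A + L2_set (\<lambda>g. cmod (coef h g q)) ?A"
    by (rule L2_set_triangle_ineq)
  also have "\<dots> = coef_norm h p + coef_norm h q"
    using coef_norm_superset[of ?A h p] coef_norm_superset[of ?A h q] by simp
  finally show ?thesis .
qed

lemma coef_norm_cauchy_schwarz: "cmod (coef h 0 (star_free p * q)) \<le> coef_norm h p * coef_norm h q"
proof -
  let ?A = "supp h p \<union> supp h q"
  have "cmod (coef h 0 (star_free p * q)) \<le> (\<Sum>g\<in>?A. cmod (coef h g p) * cmod (coef h g q))"
    by (subst coef_inner[of ?A]) (auto intro!: order_trans[OF norm_sum] simp: norm_mult)
  also have "\<dots> \<le> L2_set (\<lambda>g. cmod (coef h g p)) ?A * L2_set (\<lambda>g. cmod (coef h g q)) ?A"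
    using L2_set_mult_ineq[of "\<lambda>g. cmod (coef h g p)" "\<lambda>g. cmod (coef h g q)" ?A] by simp
  also have "\<dots> = coef_norm h p * coef_norm h q"
    using coef_norm_superset[of ?A h p] coef_norm_superset[of ?A h q] by simp
  finally show ?thesis .
qed

lemma coef_norm_zero [simp]: "coef_norm h 0 = 0"
  by (simp add: coef_norm_def)

lemma coef_norm_one [simp]: "coef_norm h 1 = 1"
  using coef_norm_power2[of h 1] coef_norm_nonneg[of h 1]
  by (simp add: coef_one power2_eq_1_iff)

lemma coef_norm_scale: "coef_norm h (scale_free c p) = cmod c * coef_norm h p"
proof -
  let ?A = "supp h p \<union> supp h (scale_free c p)"
  have "coef_norm h (scale_free c p) = L2_set (\<lambda>g. cmod c * cmod (coef h g p)) ?A"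
    by (subst coef_norm_superset[of ?A]) (auto simp: coef_scale norm_mult)
  also have "\<dots> = cmod c * coef_norm h p"
    by (subst coef_norm_superset[of ?A]) (auto simp: L2_set_right_distrib)
  finally show ?thesis .
qed

text \<open>Left translation is isometric: \<open>star_word w + w\<close> has value 0, so inserting
  it under the trace changes no coefficient.\<close>

lemma coef_norm_single_mult: "coef_norm h (Poly_Mapping.single w c * p) = cmod c * coef_norm h p"
proof -
  have "coef_norm h (Poly_Mapping.single w 1 * q) = coef_norm h q" for q
  proof -
    have "star_free (Poly_Mapping.single w 1 * q) * (Poly_Mapping.single w 1 * q) =
        star_free q * (Poly_Mapping.single (star_word w + w) 1 * q)"
      by (simp add: star_free_mult star_free_single mult.assoc) (simp add: mult_single flip: mult.assoc)
    moreover have "coef h 0 (star_free q * (Poly_Mapping.single (star_word w + w) 1 * q)) =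
        coef h 0 (star_free q * q)"
    proof -
      let ?q = "Poly_Mapping.single (star_word w + w) 1 * q"
      let ?A = "supp h ?q \<union> supp h q"
      have "finite ?A" by simp
      have "coef h g ?q = coef h g q" for g by (simp add: coef_single_mult)
      then show ?thesis using coef_inner[OF \<open>finite ?A\<close>, of h ?q q] coef_inner[OF \<open>finite ?A\<close>, of h q q]
        by simp
    qed
    ultimately have "(coef_norm h (Poly_Mapping.single w 1 * q))\<^sup>2 = (coef_norm h q)\<^sup>2"
      by (simp add: coef_norm_power2)
    then show ?thesis by simp
  qed
  moreover have "Poly_Mapping.single w c * p = Poly_Mapping.single w 1 * scale_free c p"
    by (simp add: scale_free_def mult_single flip: mult.assoc)
  ultimately show ?thesis by (simp add: coef_norm_scale)
qed

text \<open>A crude bound, adding up the norms of the translations; it makes the supremum in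
  \<open>red\<close> finite.\<close>

lemma coef_norm_mult_bounded: "\<exists>C\<ge>0. \<forall>v. coef_norm h (p * v) \<le> C * coef_norm h v"
proof (induction p rule: free_induct)
  case zero
  then show ?case by (auto intro: exI[of _ 0])
next
  case (single w c)
  then show ?case by (intro exI[of _ "cmod c"]) (simp add: coef_norm_single_mult)
next
  case (add p r)
  then obtain C D where C: "C \<ge> 0" "\<And>v. coef_norm h (p * v) \<le> C * coef_norm h v"
    and D: "D \<ge> 0" "\<And>v. coef_norm h (r * v) \<le> D * coef_norm h v" by blast
  have "coef_norm h ((p + r) * v) \<le> (C + D) * coef_norm h v" for v
    using coef_norm_triangle[of h "p * v" "r * v"] C(2)[of v] D(2)[of v]
    by (simp add: distrib_right)
  then show ?case using C(1) D(1) by (intro exI[of _ "C + D"]) auto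
qed

text \<open>The norm of the regular representation, computed on the finitely supported vectors
  that come from the free algebra.\<close>

definition red :: "('g \<Rightarrow> 'b::group_add) \<Rightarrow> 'g free_star_algebra \<Rightarrow> real" where
  "red h p = (SUP v\<in>{v. coef_norm h v \<le> 1}. coef_norm h (p * v))"

lemma red_bdd_above: "bdd_above ((\<lambda>v. coef_norm h (p * v)) ` {v. coef_norm h v \<le> 1})"
proof -
  obtain C where "C \<ge> 0" "\<And>v. coef_norm h (p * v) \<le> C * coef_norm h v"
    using coef_norm_mult_bounded[of h p] by blast
  then have "coef_norm h (p * v) \<le> C" if "coef_norm h v \<le> 1" for v
    using that by (meson mult_left_le order_trans)
  then show ?thesis by (intro bdd_aboveI2) auto
qed

lemma red_nonneg [simp]: "red h p \<ge> 0"
proof -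
  have "coef_norm h (p * 0) \<le> red h p"
    unfolding red_def by (rule cSUP_upper[OF _ red_bdd_above]) simp
  then show ?thesis by simp
qed

lemma coef_norm_mult_le: "coef_norm h (p * v) \<le> red h p * coef_norm h v"
proof (cases "coef_norm h v = 0")
  case True
  \<comment> \<open>A nonzero \<open>v\<close> may have seminorm 0; boundedness sends it to another
    null vector.\<close>
  then show ?thesis using coef_norm_mult_bounded[of h p] by (metis mult_zero_right)
next
  case False
  define n where "n = coef_norm h v"
  have n: "n > 0" using False coef_norm_nonneg[of h v] by (simp add: n_def less_le)
  have "coef_norm h (p * scale_free (complex_of_real (1/n)) v) \<le> red h p"
    unfolding red_def using n
    by (intro cSUP_upper[OF _ red_bdd_above]) (simp add: coef_norm_scale norm_divide n_def)
  then show ?thesis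
    using n by (simp add: scale_free_mult_right coef_norm_scale norm_divide n_def field_simps)
qed

lemma red_le:
  assumes "C \<ge> 0" "\<And>v. coef_norm h (p * v) \<le> C * coef_norm h v"
  shows "red h p \<le> C"
  unfolding red_def
proof (rule cSUP_least)
  show "{v. coef_norm h v \<le> 1} \<noteq> {}" by (metis coef_norm_one empty_Collect_eq order_refl)
  fix v assume "v \<in> {v. coef_norm h v \<le> 1}"
  then show "coef_norm h (p * v) \<le> C"
    using assms by (metis mem_Collect_eq mult_left_le order_trans)
qed

lemma coef_norm_le_red: "coef_norm h p \<le> red h p"
  using coef_norm_mult_le[of h p 1] by simp

lemma red_mult: "red h (p * r) \<le> red h p * red h r"
proof (rule red_le)
  fix v
  have "coef_norm h (p * (r * v)) \<le> red h p * (red h r * coef_norm h v)"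
    using coef_norm_mult_le[of h p "r * v"] mult_left_mono[OF coef_norm_mult_le[of h r v], of "red h p"]
    by simp
  then show "coef_norm h (p * r * v) \<le> red h p * red h r * coef_norm h v" by (simp add: mult.assoc)
qed simp

lemma red_add: "red h (p + r) \<le> red h p + red h r"
proof (rule red_le)
  fix v
  show "coef_norm h ((p + r) * v) \<le> (red h p + red h r) * coef_norm h v"
    using coef_norm_triangle[of h "p * v" "r * v"] coef_norm_mult_le[of h p v] coef_norm_mult_le[of h r v]
    by (simp add: distrib_right)
qed simp

lemma red_scale: "red h (scale_free c p) = cmod c * red h p"
proof -
  have le: "red h (scale_free d q) \<le> cmod d * red h q" for d q
    using coef_norm_mult_le[of h q]
    by (intro red_le) (auto simp: scale_free_mult_left coef_norm_scale mult.assoc intro!: mult_left_mono)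
  show ?thesis
  proof (cases "c = 0")
    case True
    then show ?thesis using le[of c p] red_nonneg[of h "scale_free c p"] by (auto intro: antisym)
  next
    case False
    then have "red h p \<le> inverse (cmod c) * red h (scale_free c p)"
      using le[of "inverse c" "scale_free c p"] by (simp add: scale_free_scale_free norm_inverse)
    then show ?thesis using False le[of c p] by (simp add: field_simps)
  qed
qed

text \<open>p and p* are adjoint for the trace inner product: for w = p* v the squared norm of w is
  the inner product of v and p w, and after Cauchy-Schwarz one factor cancels.\<close>

lemma red_star_le: "red h (star_free p) \<le> red h p"
proof (rule red_le)
  fix v
  let ?w = "star_free p * v"
  have "(coef_norm h ?w)\<^sup>2 = Re (coef h 0 (star_free v * (p * ?w)))"
    by (simp add: coef_norm_power2 star_free_mult mult.assoc)
  also have "\<dots> \<le> cmod (coef h 0 (star_free v * (p * ?w)))" by (rule complex_Re_le_cmod)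
  also have "\<dots> \<le> coef_norm h v * coef_norm h (p * ?w)" by (rule coef_norm_cauchy_schwarz)
  also have "\<dots> \<le> coef_norm h v * (red h p * coef_norm h ?w)"
    by (intro mult_left_mono coef_norm_mult_le) simp
  finally have "coef_norm h ?w * coef_norm h ?w \<le> red h p * coef_norm h v * coef_norm h ?w"
    by (simp add: power2_eq_square ac_simps)
  then show "coef_norm h ?w \<le> red h p * coef_norm h v"
    using coef_norm_nonneg[of h ?w] by (cases "coef_norm h ?w = 0") (auto simp: mult_le_cancel_right less_le)
qed simp

lemma red_star_mult: "red h (star_free p * p) = (red h p)\<^sup>2"
proof (rule antisym)
  show "red h (star_free p * p) \<le> (red h p)\<^sup>2"
    using red_mult[of h "star_free p" p] mult_right_mono[OF red_star_le[of h p], of "red h p"]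
    by (simp add: power2_eq_square)
  have "coef_norm h (p * v) \<le> sqrt (red h (star_free p * p)) * coef_norm h v" for v
  proof -
    have "(coef_norm h (p * v))\<^sup>2 = Re (coef h 0 (star_free v * (star_free p * p * v)))"
      by (simp add: coef_norm_power2 star_free_mult mult.assoc)
    also have "\<dots> \<le> cmod (coef h 0 (star_free v * (star_free p * p * v)))" by (rule complex_Re_le_cmod)
    also have "\<dots> \<le> coef_norm h v * coef_norm h (star_free p * p * v)" by (rule coef_norm_cauchy_schwarz)
    also have "\<dots> \<le> coef_norm h v * (red h (star_free p * p) * coef_norm h v)"
      by (intro mult_left_mono coef_norm_mult_le) simp
    also have "\<dots> = (sqrt (red h (star_free p * p)) * coef_norm h v)\<^sup>2"
      by (simp add: power_mult_distrib power2_eq_square[of "coef_norm h v"])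
    finally show ?thesis by (rule power2_le_imp_le) simp
  qed
  then have "red h p \<le> sqrt (red h (star_free p * p))" by (intro red_le) auto
  then show "(red h p)\<^sup>2 \<le> red h (star_free p * p)"
    using power_mono[of "red h p" "sqrt (red h (star_free p * p))" 2] by simp
qed

lemma cstar_seminorm_red: "cstar_seminorm (red h)"
  by (simp add: cstar_seminorm_def red_add red_scale red_mult red_star_mult)

lemma coef_mult_eq_zero:
  assumes "\<And>g. coef h g p = 0"
  shows "coef h g (p * v) = 0"
  by (induction v rule: free_induct) (auto simp: coef_mult_single assms distrib_left coef_add)

text \<open>An element with zero image in the group algebra acts as zero in the regular
  representation; this is how the relators are shown to have seminorm 0.\<close>

lemma red_eq_zero:
  assumes "\<And>g. coef h g p = 0"
  shows "red h p = 0"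
proof -
  have "coef_norm h (p * v) = 0" for v
    using coef_norm_cong[of h "p * v" 0] coef_mult_eq_zero[OF assms] by simp
  then show ?thesis using red_le[of 0 h p] red_nonneg[of h p] by simp
qed

text \<open>This norm form of positivity is preserved by every unital contraction, so it serves in place
  of spectral theory to show that the conditional expectation is positive.\<close>

lemma red_diff_star_mult_le:
  assumes c: "(red h p)\<^sup>2 \<le> c"
  shows "red h (scale_free (complex_of_real c) 1 - star_free p * p) \<le> c"
proof (rule red_le)
  show c0: "c \<ge> 0" using c by (meson order_trans zero_le_power2)
  fix v
  let ?C = "complex_of_real c" and ?n = "coef_norm h"
  let ?q = "star_free p * p * v"
  have e1: "(scale_free ?C 1 - star_free p * p) * v = scale_free ?C v - ?q"
    by (simp add: left_diff_distrib scale_free_mult_left)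
  have e2: "star_free (scale_free ?C v - ?q) * (scale_free ?C v - ?q) =
      scale_free (?C * ?C) (star_free v * v) - scale_free ?C (star_free v * ?q)
      - scale_free ?C (star_free ?q * v) + star_free ?q * ?q"
  proof -
    have d: "star_free (a - b) = star_free a - star_free b" for a b :: "'a free_star_algebra"
      using star_free_add[of "a - b" b] by simp
    show ?thesis
      by (simp add: d star_free_scale left_diff_distrib right_diff_distrib scale_free_mult_left scale_free_mult_right
          scale_free_scale_free scale_free_diff)
  qed
  have e3: "star_free v * ?q = star_free (p * v) * (p * v)" "star_free ?q * v = star_free (p * v) * (p * v)"
    by (simp_all add: star_free_mult mult.assoc)
  have "(?n ((scale_free ?C 1 - star_free p * p) * v))\<^sup>2 =
      c\<^sup>2 * Re (coef h 0 (star_free v * v)) - 2 * c * Re (coef h 0 (star_free (p * v) * (p * v)))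
      + Re (coef h 0 (star_free ?q * ?q))"
    unfolding coef_norm_power2 e1 e2 e3
    by (simp only: coef_add coef_diff coef_scale) (simp add: power2_eq_square)
  then have "(?n ((scale_free ?C 1 - star_free p * p) * v))\<^sup>2 =
      c\<^sup>2 * (?n v)\<^sup>2 - 2 * c * (?n (p * v))\<^sup>2 + (?n ?q)\<^sup>2"
    by (simp only: coef_norm_power2)
  \<comment> \<open>The cross terms contribute \<open>- 2 * c\<close> times the squared norm of p v;
    half of this absorbs the last term because \<open>(red h p)\<^sup>2 \<le> c\<close>.\<close>
  moreover have "(?n ?q)\<^sup>2 \<le> c * (?n (p * v))\<^sup>2"
  proof -
    have "?n ?q \<le> red h p * ?n (p * v)"
      using coef_norm_mult_le[of h "star_free p" "p * v"]
        mult_right_mono[OF red_star_le[of h p], of "?n (p * v)"] by (simp add: mult.assoc)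
    then have "(?n ?q)\<^sup>2 \<le> (red h p)\<^sup>2 * (?n (p * v))\<^sup>2"
      using power_mono[of "?n ?q" "red h p * ?n (p * v)" 2] by (simp add: power_mult_distrib)
    also have "\<dots> \<le> c * (?n (p * v))\<^sup>2" using c by (intro mult_right_mono) auto
    finally show ?thesis .
  qed
  moreover have "c\<^sup>2 * (?n v)\<^sup>2 - 2 * c * (?n (p * v))\<^sup>2 + c * (?n (p * v))\<^sup>2 \<le> (c * ?n v)\<^sup>2"
    using c0 by (simp add: power_mult_distrib)
  ultimately have "(?n ((scale_free ?C 1 - star_free p * p) * v))\<^sup>2 \<le> (c * ?n v)\<^sup>2" by linarith
  then show "?n ((scale_free ?C 1 - star_free p * p) * v) \<le> c * ?n v"
    by (rule power2_le_imp_le) (simp add: c0)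
qed


section \<open>Amenability of abelian-by-abelian groups\<close>

lemma eval_free_power: "eval_free \<rho> (p ^ n) = eval_free \<rho> p ^ n"
  by (induction n) (simp_all add: eval_free_mult)

lemma scaleC_sum_left: "(\<Sum>i\<in>I. f i) *\<^sub>C (x::'a::unital_cstar_algebra) = (\<Sum>i\<in>I. f i *\<^sub>C x)"
  by (induction I rule: infinite_finite_induct) (auto simp: scaleC_add_left)

lemma lookup_star_free: "Poly_Mapping.lookup (star_free p) w = cnj (Poly_Mapping.lookup p (star_word w))"
proof (induction p rule: free_induct)
  case (single v c)
  have "star_word v = w \<longleftrightarrow> v = star_word w" by (metis star_word_star_word)
  then show ?case by (simp add: star_free_single lookup_single when_def)
qed (auto simp: star_free_add lookup_add)

lemma keys_star_free_iff: "w \<in> Poly_Mapping.keys (star_free p) \<longleftrightarrow> star_word w \<in> Poly_Mapping.keys p"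
  by (simp add: in_keys_iff lookup_star_free)

section \<open>Cutting elements down to sets of words\<close>

definition restrict_words :: "('g word \<Rightarrow> bool) \<Rightarrow> 'g free_star_algebra \<Rightarrow> 'g free_star_algebra" where
  "restrict_words P p = Poly_Mapping.mapp (\<lambda>w c. if P w then c else 0) p"

lemma lookup_restrict_words:
  "Poly_Mapping.lookup (restrict_words P p) w = (if P w then Poly_Mapping.lookup p w else 0)"
  by (auto simp: restrict_words_def lookup_mapp when_def in_keys_iff)

lemma keys_restrict_words: "Poly_Mapping.keys (restrict_words P p) = {w \<in> Poly_Mapping.keys p. P w}"
  by (auto simp: in_keys_iff lookup_restrict_words split: if_splits)

lemma restrict_words_zero [simp]: "restrict_words P 0 = 0"
  by (rule poly_mapping_eqI) (simp add: lookup_restrict_words)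

lemma restrict_words_add: "restrict_words P (p + r) = restrict_words P p + restrict_words P r"
  by (rule poly_mapping_eqI) (simp add: lookup_restrict_words lookup_add)

lemma restrict_words_single:
  "restrict_words P (Poly_Mapping.single w c) = (if P w then Poly_Mapping.single w c else 0)"
  by (rule poly_mapping_eqI) (auto simp: lookup_restrict_words lookup_single when_def)

lemma restrict_words_eq_self: "Poly_Mapping.keys p \<subseteq> Collect P \<Longrightarrow> restrict_words P p = p"
  by (rule poly_mapping_eqI) (auto simp: lookup_restrict_words in_keys_iff subset_iff)

lemma restrict_words_eq_zero: "Poly_Mapping.keys p \<inter> Collect P = {} \<Longrightarrow> restrict_words P p = 0"
  by (rule poly_mapping_eqI) (auto simp: lookup_restrict_words in_keys_iff)

lemma restrict_words_scale: "restrict_words P (scale_free c p) = scale_free c (restrict_words P p)"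
  by (induction p rule: free_induct)
    (auto simp: scale_free_single restrict_words_single scale_free_add restrict_words_add)

lemma restrict_words_star:
  assumes "\<And>w. P (star_word w) \<longleftrightarrow> P w"
  shows "restrict_words P (star_free p) = star_free (restrict_words P p)"
  by (induction p rule: free_induct)
    (auto simp: star_free_single restrict_words_single star_free_add restrict_words_add assms)

text \<open>A shift rule for gradings: if appending the words of \<open>u\<close> carries
  \<open>P\<close> exactly to \<open>Q\<close>, cutting down commutes with multiplication. Two
  predicates allow a component to move to another degree.\<close>

lemma restrict_words_mult_right:
  assumes "\<And>w v. v \<in> Poly_Mapping.keys u \<Longrightarrow> P w \<longleftrightarrow> Q (w + v)"
  shows "restrict_words P p * u = restrict_words Q (p * u)"
proof (induction p rule: free_induct)
  case (single w c)
  have "Poly_Mapping.keys (Poly_Mapping.single w c * u) \<subseteq> {w + v |v. v \<in> Poly_Mapping.keys u}"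
    using keys_mult[of "Poly_Mapping.single w c" u] by (auto split: if_splits)
  then show ?case
    using assms restrict_words_eq_self[of "Poly_Mapping.single w c * u" Q]
      restrict_words_eq_zero[of "Poly_Mapping.single w c * u" Q]
    by (cases "P w") (force simp: restrict_words_single)+
qed (auto simp: restrict_words_add distrib_right)

lemma restrict_words_mult_left:
  assumes "\<And>w v. v \<in> Poly_Mapping.keys u \<Longrightarrow> P w \<longleftrightarrow> Q (v + w)"
  shows "u * restrict_words P p = restrict_words Q (u * p)"
proof (induction p rule: free_induct)
  case (single w c)
  have "Poly_Mapping.keys (u * Poly_Mapping.single w c) \<subseteq> {v + w |v. v \<in> Poly_Mapping.keys u}"
    using keys_mult[of u "Poly_Mapping.single w c"] by (auto split: if_splits)
  then show ?case
    using assms restrict_words_eq_self[of "u * Poly_Mapping.single w c" Q]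
      restrict_words_eq_zero[of "u * Poly_Mapping.single w c" Q]
    by (cases "P w") (force simp: restrict_words_single)+
qed (auto simp: restrict_words_add distrib_left)

lemma coef_restrict_words:
  "coef h g (restrict_words (\<lambda>w. P (word_val h w)) p) = (if P g then coef h g p else 0)"
  by (induction p rule: free_induct) (auto simp: restrict_words_single coef_single restrict_words_add coef_add)

lemma coef_norm_restrict_words_le: "coef_norm h (restrict_words (\<lambda>w. P (word_val h w)) p) \<le> coef_norm h p"
  by (rule coef_norm_mono) (simp add: coef_restrict_words)

lemma coef_norm_parseval:
  assumes "finite D" "\<kappa> ` supp h p \<subseteq> D"
  shows "(coef_norm h p)\<^sup>2 = (\<Sum>d\<in>D. (coef_norm h (restrict_words (\<lambda>w. \<kappa> (word_val h w) = d) p))\<^sup>2)"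
proof -
  let ?c = "\<lambda>g. (cmod (coef h g p))\<^sup>2"
  have r: "(coef_norm h (restrict_words (\<lambda>w. \<kappa> (word_val h w) = d) p))\<^sup>2 =
      (\<Sum>g\<in>supp h p. if \<kappa> g = d then ?c g else 0)" for d
  proof -
    have "(coef_norm h (restrict_words (\<lambda>w. \<kappa> (word_val h w) = d) p))\<^sup>2 =
        (\<Sum>g\<in>supp h p. (cmod (coef h g (restrict_words (\<lambda>w. \<kappa> (word_val h w) = d) p)))\<^sup>2)"
      by (subst coef_norm_superset[of "supp h p"]) (auto simp: L2_set_def sum_nonneg keys_restrict_words)
    also have "\<dots> = (\<Sum>g\<in>supp h p. if \<kappa> g = d then ?c g else 0)"
      by (rule sum.cong) (auto simp: coef_restrict_words[of h _ "\<lambda>g. \<kappa> g = d"])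
    finally show ?thesis .
  qed
  have "(\<Sum>d\<in>D. (coef_norm h (restrict_words (\<lambda>w. \<kappa> (word_val h w) = d) p))\<^sup>2) =
      (\<Sum>g\<in>supp h p. \<Sum>d\<in>D. if \<kappa> g = d then ?c g else 0)"
    unfolding r by (rule sum.swap)
  also have "\<dots> = (\<Sum>g\<in>supp h p. ?c g)"
    by (rule sum.cong) (use assms in \<open>auto simp: sum.delta\<close>)
  also have "\<dots> = (coef_norm h p)\<^sup>2"
    by (simp add: coef_norm_def L2_set_def sum_nonneg)
  finally show ?thesis by simp
qed

text \<open>The condition on \<open>\<kappa>\<close> says that its fibres are the right cosets of
  the subgroup \<open>K\<close> of all \<open>g\<close> with \<open>\<kappa> g = \<kappa> 0\<close>.
  Left multiplication by \<open>K\<close> preserves each coset, and every other element moves each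
  coset off itself. So on vectors supported on one coset the cut-down element is a compression of
  \<open>p\<close>, and these blocks are orthogonal.\<close>

lemma red_restrict_words_le:
  assumes \<kappa>: "\<And>g k. \<kappa> (g + k) = \<kappa> k \<longleftrightarrow> \<kappa> g = \<kappa> 0"
  shows "red h (restrict_words (\<lambda>w. \<kappa> (word_val h w) = \<kappa> 0) p) \<le> red h p"
proof (rule red_le)
  fix v
  let ?u = "restrict_words (\<lambda>w. \<kappa> (word_val h w) = \<kappa> 0) p"
  let ?r = "\<lambda>d. restrict_words (\<lambda>w. \<kappa> (word_val h w) = d)"
  let ?D = "\<kappa> ` supp h (?u * v) \<union> \<kappa> ` supp h v"
  have D: "finite ?D" by simp
  have "(coef_norm h (?u * v))\<^sup>2 = (\<Sum>d\<in>?D. (coef_norm h (?r d (?u * v)))\<^sup>2)"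
    by (rule coef_norm_parseval) auto
  also have "\<dots> \<le> (\<Sum>d\<in>?D. (red h p)\<^sup>2 * (coef_norm h (?r d v))\<^sup>2)"
  proof (rule sum_mono)
    fix d
    have "?r d (?u * v) = ?u * ?r d v"
    proof (rule restrict_words_mult_left[symmetric])
      fix w v assume "v \<in> Poly_Mapping.keys ?u"
      then have "\<kappa> (word_val h v) = \<kappa> 0" by (simp add: keys_restrict_words)
      then show "\<kappa> (word_val h w) = d \<longleftrightarrow> \<kappa> (word_val h (v + w)) = d"
        using \<kappa>[of "word_val h v" "word_val h w"] by simp
    qed
    also have "\<dots> = ?r d (p * ?r d v)"
      by (rule restrict_words_mult_right) (simp add: keys_restrict_words, metis \<kappa>)
    finally have "coef_norm h (?r d (?u * v)) \<le> coef_norm h (p * ?r d v)"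
      using coef_norm_restrict_words_le[of h "\<lambda>g. \<kappa> g = d"] by simp
    also have "\<dots> \<le> red h p * coef_norm h (?r d v)" by (rule coef_norm_mult_le)
    finally show "(coef_norm h (?r d (?u * v)))\<^sup>2 \<le> (red h p)\<^sup>2 * (coef_norm h (?r d v))\<^sup>2"
      by (metis coef_norm_nonneg power_mono power_mult_distrib)
  qed
  also have "\<dots> = (red h p)\<^sup>2 * (\<Sum>d\<in>?D. (coef_norm h (?r d v))\<^sup>2)" by (rule sum_distrib_left[symmetric])
  also have "(\<Sum>d\<in>?D. (coef_norm h (?r d v))\<^sup>2) = (coef_norm h v)\<^sup>2"
    by (rule coef_norm_parseval[symmetric]) auto
  finally have "(coef_norm h (?u * v))\<^sup>2 \<le> (red h p * coef_norm h v)\<^sup>2" by (simp only: power_mult_distrib)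
  then show "coef_norm h (?u * v) \<le> red h p * coef_norm h v"
    by (rule power2_le_imp_le) simp
qed simp

section \<open>The growth argument for an extension of abelian groups\<close>

text \<open>\<open>factors\<close> makes \<open>\<rho>\<close> a representation of the subgroup of
  word values; \<open>deg\<close> maps to the abelian quotient, and \<open>pos\<close> embeds the
  kernel in an abelian group. The conditions on \<open>pos\<close> concern word values only, since
  \<open>'b\<close> may contain further elements of degree zero on which they fail.\<close>

locale abelian_by_abelian_rep =
  fixes h :: "'g \<Rightarrow> 'b::group_add" and \<rho> :: "'g \<Rightarrow> 'a::unital_cstar_algebra"
    and deg :: "'b \<Rightarrow> 'c::ab_group_add" and pos :: "'b \<Rightarrow> 'd::ab_group_add"
  assumes factors: "\<And>v w. word_val h v = word_val h w \<Longrightarrow> eval_word \<rho> v = eval_word \<rho> w"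
    and deg_add: "\<And>g k. deg (g + k) = deg g + deg k"
    and pos_add: "\<And>v w. deg (word_val h v) = 0 \<Longrightarrow> deg (word_val h w) = 0 \<Longrightarrow>
      pos (word_val h v + word_val h w) = pos (word_val h v) + pos (word_val h w)"
    and pos_inj: "\<And>v w. deg (word_val h v) = 0 \<Longrightarrow> deg (word_val h w) = 0 \<Longrightarrow>
      pos (word_val h v) = pos (word_val h w) \<Longrightarrow> word_val h v = word_val h w"
begin

lemma deg_zero [simp]: "deg 0 = 0"
  using deg_add[of 0 0] by simp

lemma pos_zero [simp]: "pos 0 = 0"
  using pos_add[of 0 0] by simp

lemma deg_minus: "deg (- g) = - deg g"
  using deg_add[of "- g" g] by (simp add: eq_neg_iff_add_eq_0)

lemma deg_diff: "deg (g - k) = deg g - deg k"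
  using deg_add[of g "- k"] by (simp add: deg_minus)

lemma adj_eval_word_mult: "adj (eval_word \<rho> w) * eval_word \<rho> w = 1"
  using factors[of "star_word w + w" 0] by (simp add: eval_word_plus eval_word_star)

lemma norm_eval_word: "norm (eval_word \<rho> w) = 1"
  using norm_adj_mult[of "eval_word \<rho> w"] norm_ge_zero[of "eval_word \<rho> w"]
  by (auto simp: adj_eval_word_mult power2_eq_1_iff simp del: norm_ge_zero)

lemma eval_free_eq_sum_coef:
  "\<exists>\<pi>. (\<forall>g. norm (\<pi> g :: 'a) = 1) \<and> (\<forall>p. eval_free \<rho> p = (\<Sum>g\<in>supp h p. coef h g p *\<^sub>C \<pi> g))"
proof -
  \<comment> \<open>For a \<open>g\<close> that is the value of no word the choice still returns
    some word, so the norm claim holds for every \<open>g\<close>.\<close>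
  define \<pi> where "\<pi> g = eval_word \<rho> (SOME w. word_val h w = g)" for g
  have \<pi>: "\<pi> (word_val h w) = eval_word \<rho> w" for w
    unfolding \<pi>_def by (rule factors, rule someI) (rule refl)
  have "eval_free \<rho> p = (\<Sum>g\<in>supp h p. coef h g p *\<^sub>C \<pi> g)" for p
  proof -
    let ?K = "Poly_Mapping.keys p" and ?l = "Poly_Mapping.lookup p"
    have "eval_free \<rho> p = (\<Sum>g\<in>supp h p. \<Sum>w\<in>{w \<in> ?K. word_val h w = g}. ?l w *\<^sub>C \<pi> (word_val h w))"
      unfolding eval_free_def \<pi> by (rule sum.image_gen) simp
    also have "\<dots> = (\<Sum>g\<in>supp h p. coef h g p *\<^sub>C \<pi> g)"
      unfolding coef_def scaleC_sum_left
      by (rule sum.cong) (auto simp: sum.inter_filter intro!: sum.cong)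
    finally show ?thesis .
  qed
  then show ?thesis by (intro exI[of _ \<pi>]) (simp add: \<pi>_def norm_eval_word)
qed

text \<open>Group elements have norm one, so the l1 norm of the coefficients bounds the norm, and
  Cauchy-Schwarz against the constant 1 passes to l2.\<close>

lemma norm_eval_le_card_supp: "norm (eval_free \<rho> p) \<le> sqrt (card (supp h p)) * coef_norm h p"
proof -
  obtain \<pi> where n: "\<And>g. norm (\<pi> g :: 'a) = 1"
    and e: "eval_free \<rho> p = (\<Sum>g\<in>supp h p. coef h g p *\<^sub>C \<pi> g)"
    using eval_free_eq_sum_coef by blast
  have "norm (eval_free \<rho> p) \<le> (\<Sum>g\<in>supp h p. \<bar>1\<bar> * \<bar>cmod (coef h g p)\<bar>)"
    unfolding e by (rule order_trans[OF norm_sum]) (simp add: norm_scaleC n)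
  also have "\<dots> \<le> L2_set (\<lambda>_. 1) (supp h p) * L2_set (\<lambda>g. cmod (coef h g p)) (supp h p)"
    by (rule L2_set_mult_ineq)
  finally show ?thesis by (simp add: L2_set_constant coef_norm_def)
qed

abbreviation degree_zero :: "'g word set" where
  "degree_zero \<equiv> {w. deg (word_val h w) = 0}"

lemma norm_eval_square_power:
  "((norm (eval_free \<rho> p))\<^sup>2) ^ 2 ^ n = norm (eval_free \<rho> ((star_free p * p) ^ 2 ^ n))"
proof -
  have "adj (eval_free \<rho> (star_free p * p)) = eval_free \<rho> (star_free p * p)"
    by (simp add: eval_free_mult eval_free_star adj_mult adj_adj)
  then show ?thesis
    by (simp add: eval_free_power norm_power_self_adjoint)
      (simp add: eval_free_mult eval_free_star norm_adj_mult)
qed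

text \<open>The trivial bound \<open>sqrt (card (supp h y)) * coef_norm h y\<close> is applied to \<open>y = (p* p)\<^sup>N\<close>, whose support
  grows polynomially in \<open>N\<close> because words of degree zero commute; \<open>N\<close>-th roots remove the factor.\<close>

lemma norm_eval_le_degree_zero:
  assumes p: "Poly_Mapping.keys p \<subseteq> degree_zero" and K: "K \<ge> 0"
    and le: "\<And>v. Poly_Mapping.keys v \<subseteq> degree_zero \<Longrightarrow> coef_norm h (p * v) \<le> K * coef_norm h v"
  shows "norm (eval_free \<rho> p) \<le> K"
proof -
  let ?y = "star_free p * p"
  have mult: "Poly_Mapping.keys (a * b) \<subseteq> degree_zero"
    if "Poly_Mapping.keys a \<subseteq> degree_zero" "Poly_Mapping.keys b \<subseteq> degree_zero"
    for a b :: "'g free_star_algebra"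
    using keys_mult[of a b] that by (fastforce simp: deg_add)
  have star: "Poly_Mapping.keys (star_free p) \<subseteq> degree_zero"
  proof
    fix w assume "w \<in> Poly_Mapping.keys (star_free p)"
    then have "deg (word_val h (star_word w)) = 0" using p by (auto simp: keys_star_free_iff)
    then show "w \<in> degree_zero" by (simp add: deg_minus)
  qed
  have le_star: "coef_norm h (star_free p * v) \<le> K * coef_norm h v"
    if v: "Poly_Mapping.keys v \<subseteq> degree_zero" for v
  proof -
    let ?w = "star_free p * v"
    have "(coef_norm h ?w)\<^sup>2 = Re (coef h 0 (star_free v * (p * ?w)))"
      by (simp add: coef_norm_power2 star_free_mult mult.assoc)
    also have "\<dots> \<le> cmod (coef h 0 (star_free v * (p * ?w)))" by (rule complex_Re_le_cmod)
    also have "\<dots> \<le> coef_norm h v * coef_norm h (p * ?w)" by (rule coef_norm_cauchy_schwarz)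
    also have "\<dots> \<le> coef_norm h v * (K * coef_norm h ?w)"
      by (intro mult_left_mono le mult star v) simp
    finally have "coef_norm h ?w * coef_norm h ?w \<le> K * coef_norm h v * coef_norm h ?w"
      by (simp add: power2_eq_square ac_simps)
    then show ?thesis
      using coef_norm_nonneg[of h ?w] K by (cases "coef_norm h ?w = 0") (auto simp: mult_le_cancel_right less_le)
  qed
  have y: "Poly_Mapping.keys (?y ^ n) \<subseteq> degree_zero" for n
    by (induction n) (simp_all add: mult star p)
  have pow: "coef_norm h (?y ^ n) \<le> (K\<^sup>2) ^ n" for n
  proof (induction n)
    case (Suc n)
    have "coef_norm h (?y ^ Suc n) \<le> K * coef_norm h (p * ?y ^ n)"
      using le_star[OF mult[OF p y[of n]]] by (simp add: mult.assoc)
    also have "\<dots> \<le> K * (K * coef_norm h (?y ^ n))"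
      using K by (intro mult_left_mono le y)
    also have "\<dots> \<le> K * (K * (K\<^sup>2) ^ n)" using K Suc by (intro mult_left_mono)
    finally show ?case by (simp add: power2_eq_square mult.assoc)
  qed simp
  let ?k = "card (Poly_Mapping.keys ?y)"
  have "((norm (eval_free \<rho> p))\<^sup>2) ^ 2 ^ n \<le> real (2 ^ n + 1) ^ ?k * (K\<^sup>2) ^ 2 ^ n" for n
  proof -
    let ?Y = "?y ^ 2 ^ n"
    \<comment> \<open>Counting moves along the injective \<open>pos\<close> into an abelian group,
      where \<open>card_image_keys_power_le\<close> applies.\<close>
    have "inj_on pos (supp h ?Y)"
      using y[of "2 ^ n"] pos_inj by (intro inj_onI) auto
    then have "card (supp h ?Y) = card (pos ` supp h ?Y)" by (simp add: card_image)
    also have "\<dots> = card ((\<lambda>w. pos (word_val h w)) ` Poly_Mapping.keys ?Y)" by (simp add: image_image)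
    also have "\<dots> \<le> (2 ^ n + 1) ^ ?k"
      using y[of 1] by (intro card_image_keys_power_le[where Z = degree_zero]) (auto simp: deg_add pos_add)
    finally have c: "card (supp h ?Y) \<le> (2 ^ n + 1) ^ ?k" .
    have "sqrt (real m) \<le> real m" for m :: nat
      by (rule real_le_lsqrt) (simp_all add: power2_eq_square flip: of_nat_mult)
    then have "sqrt (card (supp h ?Y)) \<le> real ((2 ^ n + 1) ^ ?k)"
      using c by (meson of_nat_le_iff order_trans)
    then have "sqrt (card (supp h ?Y)) * coef_norm h ?Y \<le> real ((2 ^ n + 1) ^ ?k) * (K\<^sup>2) ^ 2 ^ n"
      by (intro mult_mono pow) auto
    then show ?thesis
      unfolding norm_eval_square_power using norm_eval_le_card_supp[of ?Y] by simp
  qed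
  then have "(norm (eval_free \<rho> p))\<^sup>2 \<le> K\<^sup>2" by (rule le_if_power_le_poly[rotated]) simp
  then show ?thesis using K by (rule power2_le_imp_le)
qed

text \<open>Right multiplication by the inverse of one word of degree \<open>d\<close> moves the
  component into degree zero at no cost in norm. For \<open>v\<close> of degree zero,
  \<open>?s * v\<close> has degree \<open>- d\<close>, so \<open>?q * (?s * v)\<close> is the
  degree-zero part of \<open>p * (?s * v)\<close>; this is why the preceding bound is tested on such
  \<open>v\<close> only.\<close>

lemma norm_eval_component_le:
  "norm (eval_free \<rho> (restrict_words (\<lambda>w. deg (word_val h w) = d) p)) \<le> red h p"
proof (cases "\<exists>w. deg (word_val h w) = d")
  case False
  then have "restrict_words (\<lambda>w. deg (word_val h w) = d) p = 0" by (intro restrict_words_eq_zero) auto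
  then show ?thesis by simp
next
  case True
  then obtain w where w: "deg (word_val h w) = d" by blast
  let ?q = "restrict_words (\<lambda>w. deg (word_val h w) = d) p"
  let ?s = "Poly_Mapping.single (star_word w) 1"
  have ev: "eval_free \<rho> ?s = adj (eval_word \<rho> w)" by (simp add: eval_free_single scaleC_one eval_word_star)
  have "eval_free \<rho> ?q = eval_free \<rho> (?q * ?s) * eval_word \<rho> w"
    by (simp add: eval_free_mult ev mult.assoc adj_eval_word_mult)
  then have "norm (eval_free \<rho> ?q) \<le> norm (eval_free \<rho> (?q * ?s))"
    using norm_mult_ineq[of "eval_free \<rho> (?q * ?s)" "eval_word \<rho> w"] by (simp add: norm_eval_word)
  also have "\<dots> \<le> red h p"
  proof (rule norm_eval_le_degree_zero)
    show "Poly_Mapping.keys (?q * ?s) \<subseteq> degree_zero"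
    proof
      fix u assume "u \<in> Poly_Mapping.keys (?q * ?s)"
      then obtain a where "u = a + star_word w" "a \<in> Poly_Mapping.keys ?q"
        using keys_mult[of ?q ?s] by (auto split: if_splits)
      then show "u \<in> degree_zero" using w by (simp add: keys_restrict_words deg_diff)
    qed
    fix v :: "'g free_star_algebra" assume v: "Poly_Mapping.keys v \<subseteq> degree_zero"
    have sv: "deg (word_val h u) = - d" if "u \<in> Poly_Mapping.keys (?s * v)" for u
    proof -
      note u = that
      have "Poly_Mapping.keys (?s * v) \<subseteq> {star_word w + a |a. a \<in> Poly_Mapping.keys v}"
        using keys_mult[of ?s v] by simp
      then obtain a where "u = star_word w + a" "a \<in> Poly_Mapping.keys v" using u by blast
      then show ?thesis using w v by (auto simp: deg_add deg_minus)
    qed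
    have "?q * (?s * v) = restrict_words (\<lambda>w. deg (word_val h w) = 0) (p * (?s * v))"
      by (rule restrict_words_mult_right) (simp add: deg_add sv)
    then have "coef_norm h (?q * ?s * v) \<le> coef_norm h (p * (?s * v))"
      using coef_norm_restrict_words_le[of h "\<lambda>g. deg g = 0"] by (simp add: mult.assoc)
    also have "\<dots> \<le> red h p * coef_norm h (?s * v)" by (rule coef_norm_mult_le)
    finally show "coef_norm h (?q * ?s * v) \<le> red h p * coef_norm h v"
      by (simp add: coef_norm_single_mult)
  qed simp
  finally show ?thesis .
qed

lemma norm_eval_le_card_degrees:
  "norm (eval_free \<rho> p) \<le> card ((\<lambda>w. deg (word_val h w)) ` Poly_Mapping.keys p) * red h p"
proof -
  let ?D = "(\<lambda>w. deg (word_val h w)) ` Poly_Mapping.keys p"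
  let ?r = "\<lambda>d. restrict_words (\<lambda>w. deg (word_val h w) = d) p"
  have "p = (\<Sum>d\<in>?D. ?r d)"
  proof (rule poly_mapping_eqI)
    fix w
    have "Poly_Mapping.lookup (\<Sum>d\<in>?D. ?r d) w =
        (\<Sum>d\<in>?D. if deg (word_val h w) = d then Poly_Mapping.lookup p w else 0)"
      by (simp add: lookup_sum lookup_restrict_words)
    also have "\<dots> = Poly_Mapping.lookup p w"
      by (auto simp: sum.delta in_keys_iff image_iff)
    finally show "Poly_Mapping.lookup p w = Poly_Mapping.lookup (\<Sum>d\<in>?D. ?r d) w" by simp
  qed
  moreover have "eval_free \<rho> (\<Sum>d\<in>I. f d) = (\<Sum>d\<in>I. eval_free \<rho> (f d))" for I and f :: "'c \<Rightarrow> _"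
    by (induction I rule: infinite_finite_induct) (auto simp: eval_free_add)
  ultimately have "eval_free \<rho> p = (\<Sum>d\<in>?D. eval_free \<rho> (?r d))" by metis
  then have "norm (eval_free \<rho> p) \<le> (\<Sum>d\<in>?D. norm (eval_free \<rho> (?r d)))" by (metis norm_sum)
  also have "\<dots> \<le> (\<Sum>d\<in>?D. red h p)" by (intro sum_mono norm_eval_component_le)
  finally show ?thesis by simp
qed

text \<open>The power trick a second time, with the component bound in place of the trivial one: the
  factor is now the number of degrees in a power of p* p, which is polynomial even where the
  supports grow exponentially.\<close>

theorem norm_eval_le_red: "norm (eval_free \<rho> p) \<le> red h p"
proof -
  let ?y = "star_free p * p"
  let ?k = "card (Poly_Mapping.keys ?y)"
  have pow: "red h (?y ^ n) \<le> ((red h p)\<^sup>2) ^ n" for n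
  proof (induction n)
    case 0
    have "red h 1 \<le> 1" by (rule red_le) simp_all
    then show ?case by simp
  next
    case (Suc n)
    have "red h (?y ^ Suc n) \<le> red h ?y * red h (?y ^ n)" by (simp add: red_mult)
    also have "\<dots> \<le> (red h p)\<^sup>2 * ((red h p)\<^sup>2) ^ n"
      unfolding red_star_mult by (intro mult_left_mono Suc) simp
    finally show ?case by simp
  qed
  have "((norm (eval_free \<rho> p))\<^sup>2) ^ 2 ^ n \<le> real (2 ^ n + 1) ^ ?k * ((red h p)\<^sup>2) ^ 2 ^ n" for n
  proof -
    let ?Y = "?y ^ 2 ^ n"
    let ?c = "card ((\<lambda>w. deg (word_val h w)) ` Poly_Mapping.keys ?Y)"
    have "?c \<le> (2 ^ n + 1) ^ ?k"
      by (rule card_image_keys_power_le[where Z = UNIV]) (auto simp: deg_add)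
    then have "real ?c * red h ?Y \<le> real ((2 ^ n + 1) ^ ?k) * ((red h p)\<^sup>2) ^ 2 ^ n"
      by (intro mult_mono pow of_nat_mono) auto
    then show ?thesis
      unfolding norm_eval_square_power using norm_eval_le_card_degrees[of ?Y] by simp
  qed
  then have "(norm (eval_free \<rho> p))\<^sup>2 \<le> (red h p)\<^sup>2" by (rule le_if_power_le_poly[rotated]) simp
  then show ?thesis by (rule power2_le_imp_le) simp
qed

end


section \<open>Fourier coefficients and the conditional expectation\<close>

lemma le_on_dense:
  fixes f g :: "'a::topological_space \<Rightarrow> real"
  assumes "closure D = UNIV" "continuous_on UNIV f" "continuous_on UNIV g"
    and "\<And>x. x \<in> D \<Longrightarrow> f x \<le> g x"
  shows "f x \<le> g x"
proof -
  have "closed {x. f x \<le> g x}" using assms(2,3) by (intro closed_Collect_le)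
  then have "closure D \<subseteq> {x. f x \<le> g x}" using assms(4) by (intro closure_minimal) auto
  then show ?thesis using assms(1) by auto
qed

lemma continuous_on_adj [continuous_intros]:
  "continuous_on A f \<Longrightarrow> continuous_on A (\<lambda>x. adj (f x :: 'a::unital_cstar_algebra))"
  using continuous_on_compose2[OF continuous_adj] by blast

lemma continuous_on_scaleC [continuous_intros]:
  "continuous_on A f \<Longrightarrow> continuous_on A (\<lambda>x. c *\<^sub>C (f x :: 'a::unital_cstar_algebra))"
  using continuous_on_compose2[OF continuous_scaleC] by blast

locale reduced_algebra =
  fixes h :: "'g \<Rightarrow> 'b::group_add" and \<iota> :: "'g \<Rightarrow> 'a::unital_cstar_algebra"
  assumes norm_eval: "norm (eval_free \<iota> p) = red h p"
    and dense: "closure (range (eval_free \<iota>)) = UNIV"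
begin

lemma eq_on_eval:
  fixes f g :: "'a \<Rightarrow> 'y::t2_space"
  assumes "continuous_on UNIV f" "continuous_on UNIV g" "\<And>p. f (eval_free \<iota> p) = g (eval_free \<iota> p)"
  shows "f x = g x"
  by (rule eq_on_dense[OF dense]) (use assms in auto)

lemma le_on_eval:
  fixes f g :: "'a \<Rightarrow> real"
  assumes "continuous_on UNIV f" "continuous_on UNIV g" "\<And>p. f (eval_free \<iota> p) \<le> g (eval_free \<iota> p)"
  shows "f x \<le> g x"
  by (rule le_on_dense[OF dense]) (use assms in auto)

text \<open>The bound by \<open>red\<close> makes \<open>f\<close> vanish on the kernel of
  evaluation and makes the induced map 1-Lipschitz on a dense set. The target is any Banach space,
  so scalar coefficients and algebra-valued maps are both covered.\<close>

lemma extend_from_eval: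
  fixes f :: "'g free_star_algebra \<Rightarrow> 'y::banach"
  assumes diff: "\<And>p r. f (p - r) = f p - f r" and le: "\<And>p. norm (f p) \<le> red h p"
  shows "\<exists>F. continuous_on UNIV F \<and> (\<forall>p. F (eval_free \<iota> p) = f p)"
proof -
  let ?D = "range (eval_free \<iota>)"
  define F where "F x = f (SOME p. eval_free \<iota> p = x)" for x
  have F: "F (eval_free \<iota> p) = f p" for p
  proof -
    define r where "r = (SOME r. eval_free \<iota> r = eval_free \<iota> p)"
    have "eval_free \<iota> r = eval_free \<iota> p" unfolding r_def by (rule someI) simp
    then have "red h (r - p) = 0" by (simp add: eval_free_diff flip: norm_eval)
    then have "f (r - p) = 0" using le[of "r - p"] by simp
    then show ?thesis by (simp add: F_def r_def[symmetric] diff)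
  qed
  have lip: "dist (F x) (F y) \<le> dist x y" if "x \<in> ?D" "y \<in> ?D" for x y
  proof -
    obtain p r where "x = eval_free \<iota> p" "y = eval_free \<iota> r"
      using \<open>x \<in> ?D\<close> \<open>y \<in> ?D\<close> by blast
    then show ?thesis
      using le[of "p - r"] by (simp add: F dist_norm diff flip: eval_free_diff norm_eval)
  qed
  have "uniformly_continuous_on ?D F"
    unfolding uniformly_continuous_on_def using lip by (meson le_less_trans)
  then obtain G where "uniformly_continuous_on (closure ?D) G" "\<And>x. x \<in> ?D \<Longrightarrow> F x = G x"
    by (metis uniformly_continuous_on_extension_on_closure)
  then show ?thesis
    using F dense uniformly_continuous_imp_continuous by (intro exI[of _ G]) auto
qed

definition fourier :: "'b \<Rightarrow> 'a \<Rightarrow> complex" where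
  "fourier g = (SOME F. continuous_on UNIV F \<and> (\<forall>p. F (eval_free \<iota> p) = coef h g p))"

lemma fourier: "continuous_on UNIV (fourier g) \<and> (\<forall>p. fourier g (eval_free \<iota> p) = coef h g p)"
proof -
  have "\<exists>F. continuous_on UNIV F \<and> (\<forall>p. F (eval_free \<iota> p) = coef h g p)"
    by (rule extend_from_eval)
      (auto simp: coef_diff intro: order_trans[OF coef_norm_le_cmod coef_norm_le_red])
  then show ?thesis unfolding fourier_def by (rule someI_ex)
qed

lemma fourier_eval [simp]: "fourier g (eval_free \<iota> p) = coef h g p"
  using fourier by blast

lemma continuous_on_fourier [continuous_intros]:
  "continuous_on A f \<Longrightarrow> continuous_on A (\<lambda>x. fourier g (f x))"
  using continuous_on_compose2[of UNIV "fourier g" A f] fourier by blast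

lemma fourier_diff: "fourier g (x - y) = fourier g x - fourier g y"
proof (rule eq_on_eval[of "\<lambda>x. fourier g (x - y)"])
  fix p
  show "fourier g (eval_free \<iota> p - y) = fourier g (eval_free \<iota> p) - fourier g y"
    by (rule eq_on_eval[of "\<lambda>y. fourier g (eval_free \<iota> p - y)"])
      (auto intro!: continuous_intros simp: coef_diff simp flip: eval_free_diff)
qed (auto intro!: continuous_intros)

lemma fourier_zero [simp]: "fourier g 0 = 0"
  using fourier_diff[of g 0 0] by simp

lemma fourier_add: "fourier g (x + y) = fourier g x + fourier g y"
  using fourier_diff[of g x "- y"] fourier_diff[of g 0 y] by simp

lemma fourier_single_mult:
  "fourier g (eval_free \<iota> (Poly_Mapping.single w c) * x) = c * fourier (- word_val h w + g) x"
  by (rule eq_on_eval)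
    (auto intro!: continuous_intros simp: coef_single_mult simp flip: eval_free_mult)

lemma fourier_mult_single:
  "fourier g (x * eval_free \<iota> (Poly_Mapping.single w c)) = fourier (g - word_val h w) x * c"
  by (rule eq_on_eval)
    (auto intro!: continuous_intros simp: coef_mult_single simp flip: eval_free_mult)

text \<open>For a finite index set the left side is continuous, so the l2 bound passes from the
  dense subalgebra to all elements.\<close>

lemma fourier_bessel:
  assumes "finite A"
  shows "(\<Sum>g\<in>A. (cmod (fourier g x))\<^sup>2) \<le> (norm x)\<^sup>2"
proof (rule le_on_eval[of "\<lambda>x. \<Sum>g\<in>A. (cmod (fourier g x))\<^sup>2"])
  fix p
  have "(\<Sum>g\<in>A. (cmod (coef h g p))\<^sup>2) \<le> (red h p)\<^sup>2"
    using sum_cmod_coef_le[OF assms, of h p] coef_norm_le_red[of h p]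
    by (meson coef_norm_nonneg order_trans power_mono)
  then show "(\<Sum>g\<in>A. (cmod (fourier g (eval_free \<iota> p)))\<^sup>2) \<le> (norm (eval_free \<iota> p))\<^sup>2"
    by (simp add: norm_eval)
qed (auto intro!: continuous_intros)

text \<open>\<open>fourier 0\<close> is the extended trace; its vanishing on
  \<open>adj x * x\<close> therefore kills every coefficient of \<open>x\<close>.\<close>

lemma cmod_fourier_le: "(cmod (fourier g x))\<^sup>2 \<le> Re (fourier 0 (adj x * x))"
proof (rule le_on_eval[of "\<lambda>x. (cmod (fourier g x))\<^sup>2"])
  fix p
  have "(cmod (coef h g p))\<^sup>2 \<le> Re (coef h 0 (star_free p * p))"
    unfolding coef_norm_power2[symmetric] by (intro power_mono coef_norm_le_cmod) simp
  then show "(cmod (fourier g (eval_free \<iota> p)))\<^sup>2 \<le>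
      Re (fourier 0 (adj (eval_free \<iota> p) * eval_free \<iota> p))"
    by (simp flip: eval_free_star eval_free_mult)
qed (auto intro!: continuous_intros)

text \<open>The trace expression is the matrix coefficient of \<open>x\<close> between the vectors
  \<open>a\<close> and \<open>b\<close> of the regular representation.\<close>

lemma fourier_sandwich_le:
  "cmod (fourier 0 (eval_free \<iota> (star_free a) * (x * eval_free \<iota> b))) \<le>
    coef_norm h a * (norm x * coef_norm h b)"
proof (rule le_on_eval[of "\<lambda>x. cmod (fourier 0 (eval_free \<iota> (star_free a) * (x * eval_free \<iota> b)))"])
  fix p
  have "cmod (coef h 0 (star_free a * (p * b))) \<le> coef_norm h a * (red h p * coef_norm h b)"
    by (rule order_trans[OF coef_norm_cauchy_schwarz mult_left_mono[OF coef_norm_mult_le]]) simp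
  then show "cmod (fourier 0 (eval_free \<iota> (star_free a) * (eval_free \<iota> p * eval_free \<iota> b))) \<le>
    coef_norm h a * (norm (eval_free \<iota> p) * coef_norm h b)"
    by (simp add: norm_eval flip: eval_free_mult)
qed (auto intro!: continuous_intros)

text \<open>Vanishing coefficients make all matrix coefficients of \<open>x\<close> vanish. If
  \<open>p\<close> approximates \<open>x\<close> within \<open>e\<close>, the matrix coefficients of
  \<open>p\<close> equal those of \<open>p - x\<close>, so \<open>p\<close> itself has norm at most
  \<open>e\<close>.\<close>

theorem fourier_eq_zero_imp:
  assumes zero: "\<And>g. fourier g x = 0"
  shows "x = 0"
proof -
  have right: "fourier g (x * eval_free \<iota> b) = 0" for g b
    by (induction b rule: free_induct)
      (auto simp: fourier_mult_single zero eval_free_add distrib_left fourier_add)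
  have both: "fourier g (eval_free \<iota> a * (x * eval_free \<iota> b)) = 0" for g a b
    by (induction a rule: free_induct)
      (auto simp: fourier_single_mult right eval_free_add distrib_right fourier_add)
  have le: "norm x \<le> 2 * e" if e: "e > 0" for e
  proof -
    have "x \<in> closure (range (eval_free \<iota>))" using dense by simp
    then obtain p where p: "norm (eval_free \<iota> p - x) < e"
      using e unfolding closure_approachable by (auto simp: dist_norm)
    have "red h p \<le> e"
    proof (rule red_le)
      fix b
      \<comment> \<open>Testing against \<open>p * b\<close> itself turns the matrix coefficient
        into a squared norm.\<close>
      let ?a = "p * b"
      have "(coef_norm h ?a)\<^sup>2 \<le> cmod (coef h 0 (star_free ?a * (p * b)))"
        unfolding coef_norm_power2 by (rule complex_Re_le_cmod)
      also have "\<dots> = cmod (fourier 0 (eval_free \<iota> (star_free ?a) * (eval_free \<iota> p * eval_free \<iota> b)))"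
        by (simp flip: eval_free_mult)
      also have "fourier 0 (eval_free \<iota> (star_free ?a) * (eval_free \<iota> p * eval_free \<iota> b)) =
          fourier 0 (eval_free \<iota> (star_free ?a) * ((eval_free \<iota> p - x) * eval_free \<iota> b))"
        using both[of 0 "star_free ?a" b] by (simp add: left_diff_distrib right_diff_distrib fourier_diff)
      also have "cmod \<dots> \<le> coef_norm h ?a * (norm (eval_free \<iota> p - x) * coef_norm h b)"
        by (rule fourier_sandwich_le)
      also have "\<dots> \<le> coef_norm h ?a * (e * coef_norm h b)"
        using p by (intro mult_left_mono mult_right_mono) auto
      finally have "coef_norm h ?a * coef_norm h ?a \<le> e * coef_norm h b * coef_norm h ?a"
        by (simp add: power2_eq_square ac_simps)
      then show "coef_norm h ?a \<le> e * coef_norm h b"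
        using coef_norm_nonneg[of h ?a] coef_norm_nonneg[of h b] e
        by (cases "coef_norm h ?a = 0") (auto simp: mult_le_cancel_right less_le)
    qed (use e in simp)
    then have "norm (eval_free \<iota> p) \<le> e" by (simp add: norm_eval)
    then show ?thesis using p norm_triangle_sub[of x "eval_free \<iota> p"] by (simp add: norm_minus_commute)
  qed
  have "norm x \<le> 0 + e" if "e > 0" for e
    using le[of "e / 2"] that by simp
  then have "norm x \<le> 0" by (rule field_le_epsilon)
  then show ?thesis by simp
qed

lemma fourier_eq_imp: "(\<And>g. fourier g x = fourier g y) \<Longrightarrow> x = y"
  using fourier_eq_zero_imp[of "x - y"] by (simp add: fourier_diff)

lemma norm_diff_adj_mult_le: "norm ((norm x)\<^sup>2 *\<^sub>R 1 - adj x * x) \<le> (norm (x::'a))\<^sup>2"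
proof (rule le_on_eval[of "\<lambda>x. norm ((norm x)\<^sup>2 *\<^sub>R 1 - adj x * x)" "\<lambda>x. (norm x)\<^sup>2"])
  fix p
  have "(norm (eval_free \<iota> p))\<^sup>2 *\<^sub>R 1 - adj (eval_free \<iota> p) * eval_free \<iota> p =
      eval_free \<iota> (scale_free (complex_of_real ((red h p)\<^sup>2)) 1 - star_free p * p)"
    by (simp add: eval_free_diff eval_free_scale eval_free_mult eval_free_star scaleR_scaleC norm_eval)
  then show "norm ((norm (eval_free \<iota> p))\<^sup>2 *\<^sub>R 1 - adj (eval_free \<iota> p) * eval_free \<iota> p) \<le>
      (norm (eval_free \<iota> p))\<^sup>2"
    by (simp only: norm_eval red_diff_star_mult_le order_refl)
qed (auto intro!: continuous_intros)

end

section \<open>The expectation onto the part supported on a subgroup\<close>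

locale reduced_algebra_expectation = reduced_algebra h \<iota>
  for h :: "'g \<Rightarrow> 'b::group_add" and \<iota> :: "'g \<Rightarrow> 'a::unital_cstar_algebra" +
  fixes \<kappa> :: "'b \<Rightarrow> 'c"
  assumes \<kappa>: "\<And>g k. \<kappa> (g + k) = \<kappa> k \<longleftrightarrow> \<kappa> g = \<kappa> 0"
begin

abbreviation kernel_part :: "'g free_star_algebra \<Rightarrow> 'g free_star_algebra" where
  "kernel_part \<equiv> restrict_words (\<lambda>w. \<kappa> (word_val h w) = \<kappa> 0)"

definition expect :: "'a \<Rightarrow> 'a" where
  "expect = (SOME F. continuous_on UNIV F \<and> (\<forall>p. F (eval_free \<iota> p) = eval_free \<iota> (kernel_part p)))"

lemma kernel_part_diff: "kernel_part (p - r) = kernel_part p - kernel_part r"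
  using restrict_words_add[of _ "p - r" r] by simp

lemma expect: "continuous_on UNIV expect \<and>
    (\<forall>p. expect (eval_free \<iota> p) = eval_free \<iota> (kernel_part p))"
proof -
  have "\<exists>F. continuous_on UNIV F \<and> (\<forall>p. F (eval_free \<iota> p) = eval_free \<iota> (kernel_part p))"
    by (rule extend_from_eval)
      (auto simp: kernel_part_diff eval_free_diff norm_eval red_restrict_words_le[OF \<kappa>])
  then show ?thesis unfolding expect_def by (rule someI_ex)
qed

lemma expect_eval [simp]: "expect (eval_free \<iota> p) = eval_free \<iota> (kernel_part p)"
  using expect by blast

lemma continuous_on_expect [continuous_intros]:
  "continuous_on A f \<Longrightarrow> continuous_on A (\<lambda>x. expect (f x))"
  using continuous_on_compose2[of UNIV expect A f] expect by blast

lemma \<kappa>_minus: "\<kappa> (- g) = \<kappa> 0 \<longleftrightarrow> \<kappa> g = \<kappa> 0"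
  using \<kappa>[of "- g" g] by auto

lemma expect_add: "expect (x + y) = expect x + expect y"
proof (rule eq_on_eval[of "\<lambda>x. expect (x + y)"])
  fix p
  show "expect (eval_free \<iota> p + y) = expect (eval_free \<iota> p) + expect y"
    by (rule eq_on_eval[of "\<lambda>y. expect (eval_free \<iota> p + y)"])
      (auto intro!: continuous_intros simp: restrict_words_add simp flip: eval_free_add)
qed (auto intro!: continuous_intros)

lemma expect_scaleC: "expect (c *\<^sub>C x) = c *\<^sub>C expect x"
  by (rule eq_on_eval)
    (auto intro!: continuous_intros simp: restrict_words_scale simp flip: eval_free_scale)

lemma expect_diff: "expect (x - y) = expect x - expect y"
  using expect_add[of "x - y" y] by simp

lemma expect_adj: "expect (adj x) = adj (expect x)"
  by (rule eq_on_eval)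
    (auto intro!: continuous_intros simp: restrict_words_star \<kappa>_minus simp flip: eval_free_star)

lemma norm_expect_le: "norm (expect x) \<le> norm x"
  by (rule le_on_eval) (auto intro!: continuous_intros simp: norm_eval red_restrict_words_le[OF \<kappa>])

lemma expect_expect [simp]: "expect (expect x) = expect x"
proof (rule eq_on_eval[of "\<lambda>x. expect (expect x)" expect])
  fix p
  have "kernel_part (kernel_part p) = kernel_part p"
    by (rule restrict_words_eq_self) (auto simp: keys_restrict_words)
  then show "expect (expect (eval_free \<iota> p)) = expect (eval_free \<iota> p)" by simp
qed (auto intro!: continuous_intros)

lemma expect_one [simp]: "expect 1 = 1"
proof -
  have "kernel_part 1 = 1" by (rule restrict_words_eq_self) simp
  then show ?thesis using expect_eval[of 1] by simp
qed

lemma expect_mult_left: "expect (expect x * y) = expect x * expect y"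
proof (rule eq_on_eval[of "\<lambda>x. expect (expect x * y)"])
  fix p
  show "expect (expect (eval_free \<iota> p) * y) = expect (eval_free \<iota> p) * expect y"
  proof (rule eq_on_eval[of "\<lambda>y. expect (expect (eval_free \<iota> p) * y)"])
    fix r
    have "kernel_part p * kernel_part r = kernel_part (kernel_part p * r)"
    proof (rule restrict_words_mult_left)
      fix w v assume "v \<in> Poly_Mapping.keys (kernel_part p)"
      then show "\<kappa> (word_val h w) = \<kappa> 0 \<longleftrightarrow> \<kappa> (word_val h (v + w)) = \<kappa> 0"
        using \<kappa>[of "word_val h v" "word_val h w"] by (simp add: keys_restrict_words)
    qed
    then show "expect (expect (eval_free \<iota> p) * eval_free \<iota> r) =
        expect (eval_free \<iota> p) * expect (eval_free \<iota> r)"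
      by (simp flip: eval_free_mult)
  qed (auto intro!: continuous_intros)
qed (auto intro!: continuous_intros)

lemma expect_mult_right: "expect (y * expect x) = expect y * expect x"
proof -
  have "adj (expect (y * expect x)) = adj (expect y * expect x)"
    using expect_mult_left[of "adj x" "adj y"] by (simp add: expect_adj adj_mult flip: expect_adj)
  then show ?thesis by (metis adj_adj)
qed

lemma fourier_expect: "fourier g (expect x) = (if \<kappa> g = \<kappa> 0 then fourier g x else 0)"
  by (rule eq_on_eval; cases "\<kappa> g = \<kappa> 0")
    (auto intro!: continuous_intros simp: coef_restrict_words[of h _ "\<lambda>g. \<kappa> g = \<kappa> 0"])

lemma positive_expect:
  assumes "positive x"
  shows "positive (expect x)"
proof -
  obtain a where a: "x = adj a * a" using assms by (auto simp: positive_def)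
  have "expect ((norm a)\<^sup>2 *\<^sub>R 1 - x) = (norm a)\<^sup>2 *\<^sub>R 1 - expect x"
    by (simp add: expect_diff scaleR_scaleC expect_scaleC)
  then have "norm ((norm a)\<^sup>2 *\<^sub>R 1 - expect x) \<le> (norm a)\<^sup>2"
    using norm_expect_le[of "(norm a)\<^sup>2 *\<^sub>R 1 - x"] norm_diff_adj_mult_le[of a] a by simp
  moreover have "adj (expect x) = expect x" by (simp add: a adj_mult adj_adj flip: expect_adj)
  ultimately show ?thesis by (rule positive_if_norm_diff_le[rotated])
qed

text \<open>The neutral element lies in the subgroup, so \<open>expect\<close> preserves the trace,
  and the trace of \<open>adj x * x\<close> dominates the square of every coefficient of
  \<open>x\<close>.\<close>

lemma faithful_expect: "faithful expect"
  unfolding faithful_def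
proof (intro allI impI)
  fix x assume "expect (adj x * x) = 0"
  then have "fourier 0 (adj x * x) = 0" using fourier_expect[of 0 "adj x * x"] by simp
  then have "fourier g x = 0" for g using cmod_fourier_le[of g x] by simp
  then show "x = 0" by (rule fourier_eq_zero_imp)
qed

lemma conditional_expectation_expect:
  assumes B: "B = {x. expect x = x}"
  shows "conditional_expectation B expect"
  unfolding conditional_expectation_def B
proof (intro conjI allI ballI impI)
  fix b x assume "b \<in> {x. expect x = x}"
  then have b: "expect b = b" by simp
  show "expect (b * x) = b * expect x" using expect_mult_left[of b x] b by simp
  show "expect (x * b) = expect x * b" using expect_mult_right[of x b] b by simp
qed (auto simp: expect_add expect_scaleC positive_expect norm_expect_le)

end


section \<open>The diagonal of the self-similar graph algebra\<close>

text \<open>The triple \<open>(n, q, d)\<close> acts on the rationals as \<open>x \<mapsto> q * x + n\<close>. Keeping the scale \<open>q\<close> as a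
  separate coordinate makes the type independent of \<open>m\<close>: the semidirect product
  of \<open>\<int>[1/m\<^sub>1, \<dots>, 1/m\<^sub>k]\<close> and \<open>\<int>\<^sup>k\<close> is the subgroup generated by the images of \<open>a\<close> and of the edges.\<close>

typedef ('k::finite) affine = "{x :: rat \<times> rat \<times> (int ^ 'k). fst (snd x) \<noteq> 0}"
  by (rule exI[of _ "(0, 1, 0)"]) simp

setup_lifting type_definition_affine

lift_definition aff_trans :: "'k::finite affine \<Rightarrow> rat" is fst .
lift_definition aff_scale :: "'k::finite affine \<Rightarrow> rat" is "\<lambda>x. fst (snd x)" .
lift_definition aff_deg :: "'k::finite affine \<Rightarrow> int ^ 'k" is "\<lambda>x. snd (snd x)" .
text \<open>The default scale 1 only keeps the function total: products and quotients of nonzero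
  scales never reach it.\<close>

lift_definition mk_aff :: "rat \<Rightarrow> rat \<Rightarrow> int ^ 'k::finite \<Rightarrow> 'k affine" is
  "\<lambda>n q d. (n, if q = 0 then 1 else q, d)" by simp

lemma mk_aff_simps [simp]:
  "aff_trans (mk_aff n q d) = n" "q \<noteq> 0 \<Longrightarrow> aff_scale (mk_aff n q d) = q" "aff_deg (mk_aff n q d) = d"
  by (transfer; simp)+

lemma aff_scale_nonzero [simp]: "aff_scale g \<noteq> 0"
  by transfer simp

lemma affine_eq_iff: "g = k \<longleftrightarrow> aff_trans g = aff_trans k \<and> aff_scale g = aff_scale k \<and> aff_deg g = aff_deg k"
  by transfer (auto simp: prod_eq_iff)

instantiation affine :: (finite) group_add
begin

definition zero_affine :: "'a affine" where "0 = mk_aff 0 1 0"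
definition plus_affine :: "'a affine \<Rightarrow> 'a affine \<Rightarrow> 'a affine" where
  "g + k = mk_aff (aff_trans g + aff_scale g * aff_trans k) (aff_scale g * aff_scale k) (aff_deg g + aff_deg k)"
definition uminus_affine :: "'a affine \<Rightarrow> 'a affine" where
  "- g = mk_aff (- aff_trans g / aff_scale g) (1 / aff_scale g) (- aff_deg g)"
definition minus_affine :: "'a affine \<Rightarrow> 'a affine \<Rightarrow> 'a affine" where
  "g - k = mk_aff (aff_trans g - aff_scale g / aff_scale k * aff_trans k) (aff_scale g / aff_scale k)
    (aff_deg g - aff_deg k)"

instance
  by standard
    (auto simp: zero_affine_def plus_affine_def uminus_affine_def minus_affine_def affine_eq_iff algebra_simps)

end

lemma affine_simps [simp]:
  fixes g k :: "'k::finite affine"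
  shows "aff_trans (0 :: 'k affine) = 0" "aff_scale (0 :: 'k affine) = 1" "aff_deg (0 :: 'k affine) = 0"
    "aff_trans (g + k) = aff_trans g + aff_scale g * aff_trans k"
    "aff_scale (g + k) = aff_scale g * aff_scale k" "aff_deg (g + k) = aff_deg g + aff_deg k"
    "aff_trans (- g) = - aff_trans g / aff_scale g" "aff_scale (- g) = 1 / aff_scale g"
    "aff_deg (- g) = - aff_deg g" "aff_trans (g - k) = aff_trans g - aff_scale g / aff_scale k * aff_trans k"
    "aff_scale (g - k) = aff_scale g / aff_scale k" "aff_deg (g - k) = aff_deg g - aff_deg k"
  by (simp_all add: zero_affine_def plus_affine_def uminus_affine_def minus_affine_def)

definition path_weight :: "('k::finite \<Rightarrow> int) \<Rightarrow> 'k path \<Rightarrow> int" where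
  "path_weight m \<mu> = (\<Prod>i\<in>UNIV. m i ^ count \<mu> i)"

lemma path_weight_plus: "path_weight m (\<mu> + \<nu>) = path_weight m \<mu> * path_weight m \<nu>"
  by (simp add: path_weight_def power_add prod.distrib)

lemma restriction_eq: "restriction m l \<mu> = l * path_weight m \<mu>"
  by (simp add: restriction_def path_weight_def)

definition path_degree :: "'k::finite path \<Rightarrow> int ^ 'k" where
  "path_degree \<mu> = (\<chi> i. int (count \<mu> i))"

lemma path_degree_plus: "path_degree (\<mu> + \<nu>) = path_degree \<mu> + path_degree \<nu>"
  by (simp add: path_degree_def vec_eq_iff)

lemma path_degree_inj: "path_degree \<mu> = path_degree \<nu> \<Longrightarrow> \<mu> = \<nu>"
  by (rule multiset_eqI) (simp add: path_degree_def vec_eq_iff)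

text \<open>The scale of a path is its inverse weight: commuting \<open>U g\<close> past a path of
  weight \<open>w\<close> gives \<open>U (g * w)\<close>, and translation by \<open>g * w\<close>,
  scaled by that factor, has to be translation by \<open>g\<close>.\<close>

fun affine_gen :: "('k::finite \<Rightarrow> int) \<Rightarrow> 'k generator \<Rightarrow> 'k affine" where
  "affine_gen m (U g) = mk_aff (of_int g) 1 0"
| "affine_gen m (S \<mu>) = mk_aff 0 (1 / of_int (path_weight m \<mu>)) (path_degree \<mu>)"

definition torus_char :: "('k::finite \<Rightarrow> complex) \<Rightarrow> int ^ 'k \<Rightarrow> complex" where
  "torus_char t d = (\<Prod>i\<in>UNIV. t i powi (d $ i))"

lemma torus_char_zero [simp]: "torus_char t 0 = 1"
  by (simp add: torus_char_def)

lemma torus_char_separates: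
  assumes "d \<noteq> 0"
  shows "\<exists>t\<in>torus. torus_char t d \<noteq> 1"
proof -
  obtain i where i: "d $ i \<noteq> 0" using assms by (auto simp: vec_eq_iff)
  \<comment> \<open>Entry \<open>i\<close> is chosen so that its power \<open>d $ i\<close>, of
    either sign, is \<open>cis pi\<close>, that is -1.\<close>
  define t where "t j = (if j = i then cis (pi / real_of_int (d $ i)) else 1)" for j
  have "torus_char t d = (\<Prod>j\<in>UNIV. if j = i then cis (pi / real_of_int (d $ i)) powi (d $ i) else 1)"
    unfolding torus_char_def by (rule prod.cong) (auto simp: t_def)
  also have "\<dots> = -1" using i by (simp add: cis_power_int)
  finally show ?thesis by (intro bexI[of _ t]) (auto simp: torus_def t_def)
qed

lemma eval_free_commute:
  assumes "\<And>v w. v \<in> Poly_Mapping.keys p \<Longrightarrow> w \<in> Poly_Mapping.keys r \<Longrightarrow>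
    eval_word \<rho> v * eval_word \<rho> w = eval_word \<rho> w * eval_word \<rho> v"
  shows "eval_free \<rho> p * eval_free \<rho> r = eval_free \<rho> r * eval_free \<rho> p"
proof -
  have "eval_free \<rho> p * eval_free \<rho> r =
      (\<Sum>v\<in>Poly_Mapping.keys p. \<Sum>w\<in>Poly_Mapping.keys r. (Poly_Mapping.lookup r w *\<^sub>C eval_word \<rho> w) *
        (Poly_Mapping.lookup p v *\<^sub>C eval_word \<rho> v))"
    unfolding eval_free_def sum_product
    by (intro sum.cong refl)
      (simp add: mult_scaleC_left mult_scaleC_right scaleC_scaleC mult.commute, metis assms)
  also have "\<dots> = eval_free \<rho> r * eval_free \<rho> p"
    unfolding eval_free_def sum_product by (rule sum.swap)
  finally show ?thesis .
qed

abbreviation letter_word :: "'g \<Rightarrow> 'g word" where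
  "letter_word x \<equiv> Word [Plain x]"

lemma eval_letter_word [simp]: "eval_word \<rho> (letter_word x) = \<rho> x"
  by (simp add: eval_word_def)

lemma word_val_letter_word [simp]: "word_val h (letter_word x) = h x"
  by (simp add: word_val_def)

section \<open>Normal forms and the norm of the universal algebra\<close>

locale self_similar_algebra =
  fixes m :: "'k::finite \<Rightarrow> int" and \<iota> :: "'k generator \<Rightarrow> 'a::unital_cstar_algebra"
  assumes m_nonzero: "\<And>i. m i \<noteq> 0"
    and universal: "universal_cstar_algebra (relators m) \<iota>"
begin

abbreviation val :: "'k generator word \<Rightarrow> 'k affine" where
  "val \<equiv> word_val (affine_gen m)"

abbreviation weight :: "'k path \<Rightarrow> rat" where
  "weight \<mu> \<equiv> of_int (path_weight m \<mu>)"

lemma weight_nonzero [simp]: "path_weight m \<mu> \<noteq> 0"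
  by (simp add: path_weight_def m_nonzero)

lemma relations: "satisfies_relators (relators m) \<iota>"
  using universal by (simp add: universal_cstar_algebra_def)

lemma U_mult_adj: "\<iota> (U g) * adj (\<iota> (U g)) = 1"
  and adj_S_mult: "adj (\<iota> (S \<mu>)) * \<iota> (S \<mu>) = 1"
  and S_mult_adj: "\<iota> (S \<mu>) * adj (\<iota> (S \<mu>)) = 1"
  and U_plus: "\<iota> (U (g + k)) = \<iota> (U g) * \<iota> (U k)"
  and S_plus: "\<iota> (S (\<mu> + \<nu>)) = \<iota> (S \<mu>) * \<iota> (S \<nu>)"
  and U_mult_S: "\<iota> (U g) * \<iota> (S \<mu>) = \<iota> (S \<mu>) * \<iota> (U (g * path_weight m \<mu>))"
  using relations[unfolded satisfies_relators_iff] by (auto simp: restriction_eq)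

lemmas U_zero = satisfies_relators_units(1)[OF relations]
  and S_zero = satisfies_relators_units(2)[OF relations]

lemma adj_U: "adj (\<iota> (U g)) = \<iota> (U (- g))"
proof -
  have "\<iota> (U (- g)) * \<iota> (U g) = 1" using U_plus[of "- g" g] by (simp add: U_zero)
  then show ?thesis by (metis U_mult_adj mult.assoc mult_1_left mult_1_right)
qed

lemma adj_S_mult_U: "adj (\<iota> (S \<mu>)) * \<iota> (U g) = \<iota> (U (g * path_weight m \<mu>)) * adj (\<iota> (S \<mu>))"
proof -
  have "adj (\<iota> (S \<mu>)) * \<iota> (U g) = adj (\<iota> (S \<mu>)) * (\<iota> (U g) * \<iota> (S \<mu>)) * adj (\<iota> (S \<mu>))"
    by (simp add: mult.assoc S_mult_adj)
  also have "\<dots> = (adj (\<iota> (S \<mu>)) * \<iota> (S \<mu>)) * \<iota> (U (g * path_weight m \<mu>)) * adj (\<iota> (S \<mu>))"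
    by (simp only: U_mult_S mult.assoc)
  finally show ?thesis by (simp add: adj_S_mult)
qed

lemma adj_S_mult_S: "adj (\<iota> (S \<mu>)) * \<iota> (S \<nu>) = \<iota> (S \<nu>) * adj (\<iota> (S \<mu>))"
proof -
  have "\<iota> (S \<nu>) * \<iota> (S \<mu>) = \<iota> (S \<mu>) * \<iota> (S \<nu>)" by (metis S_plus add.commute)
  then have "adj (\<iota> (S \<mu>)) * (\<iota> (S \<nu>) * \<iota> (S \<mu>)) * adj (\<iota> (S \<mu>)) = \<iota> (S \<nu>) * adj (\<iota> (S \<mu>))"
    by (simp add: adj_S_mult flip: mult.assoc)
  then show ?thesis by (simp add: mult.assoc S_mult_adj)
qed

definition monomial :: "'k path \<Rightarrow> int \<Rightarrow> 'k path \<Rightarrow> 'a" where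
  "monomial \<mu> g \<nu> = \<iota> (S \<mu>) * \<iota> (U g) * adj (\<iota> (S \<nu>))"

text \<open>This is \<open>affine_gen m (S \<mu>) + affine_gen m (U g) - affine_gen m (S
  \<nu>)\<close>, multiplied out.\<close>

definition monomial_val :: "'k path \<Rightarrow> int \<Rightarrow> 'k path \<Rightarrow> 'k affine" where
  "monomial_val \<mu> g \<nu> = mk_aff (of_int g / weight \<mu>) (weight \<nu> / weight \<mu>) (path_degree \<mu> - path_degree \<nu>)"

text \<open>Letters are absorbed from the left. Edges are commuting unitaries, so a starred edge
  passes the edges unchanged and passes \<open>U g\<close> by multiplying the exponent with its
  weight; exponents are never divided.\<close>

lemma word_normal_form: "\<exists>\<mu> g \<nu>. eval_word \<iota> w = monomial \<mu> g \<nu> \<and> val w = monomial_val \<mu> g \<nu>"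
proof -
  have "\<exists>\<mu> g \<nu>. eval_word \<iota> (Word xs) = monomial \<mu> g \<nu> \<and> val (Word xs) = monomial_val \<mu> g \<nu>" for xs
  proof (induction xs)
    case Nil
    show ?case
      by (intro exI[of _ "{#}"] exI[of _ 0])
        (simp add: monomial_def monomial_val_def eval_word_def word_val_def U_zero S_zero
          path_weight_def zero_affine_def)
  next
    case (Cons x xs)
    then obtain \<mu> g \<nu> where IH: "eval_word \<iota> (Word xs) = monomial \<mu> g \<nu>" "val (Word xs) = monomial_val \<mu> g \<nu>"
      by blast
    have ev: "eval_word \<iota> (Word (x # xs)) = eval_letter \<iota> x * monomial \<mu> g \<nu>"
      using IH(1) by (simp add: eval_word_def)
    have va: "val (Word (x # xs)) = letter_val (affine_gen m) x + monomial_val \<mu> g \<nu>"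
      using IH(2) by (simp add: word_val_def)
    have U: "\<iota> (U k) * monomial \<mu> g \<nu> = monomial \<mu> (k * path_weight m \<mu> + g) \<nu>" for k
      by (simp add: monomial_def U_plus U_mult_S flip: mult.assoc)
    consider k where "x = Plain (U k)" | k where "x = Starred (U k)"
      | \<xi> where "x = Plain (S \<xi>)" | \<xi> where "x = Starred (S \<xi>)"
      by (cases x; metis generator.exhaust)
    then show ?case
    proof cases
      case 1
      then show ?thesis
        unfolding ev va
        by (intro exI[of _ \<mu>] exI[of _ "k * path_weight m \<mu> + g"] exI[of _ \<nu>])
          (simp add: U monomial_val_def affine_eq_iff field_simps)
    next
      case 2
      then show ?thesis
        unfolding ev va
        by (intro exI[of _ \<mu>] exI[of _ "(- k) * path_weight m \<mu> + g"] exI[of _ \<nu>])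
          (simp add: adj_U U[of "- k"] monomial_val_def affine_eq_iff field_simps)
    next
      case 3
      then show ?thesis
        unfolding ev va
        by (intro exI[of _ "\<xi> + \<mu>"] exI[of _ g] exI[of _ \<nu>])
          (simp add: monomial_def S_plus mult.assoc monomial_val_def affine_eq_iff path_weight_plus
            path_degree_plus)
    next
      case 4
      have "adj (\<iota> (S \<xi>)) * monomial \<mu> g \<nu> = \<iota> (S \<mu>) * (adj (\<iota> (S \<xi>)) * \<iota> (U g)) * adj (\<iota> (S \<nu>))"
        by (simp add: monomial_def adj_S_mult_S flip: mult.assoc)
      also have "\<dots> = monomial \<mu> (g * path_weight m \<xi>) (\<nu> + \<xi>)"
        by (simp add: monomial_def adj_S_mult_U S_plus adj_mult mult.assoc)
      finally show ?thesis
        using 4 unfolding ev va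
        by (intro exI[of _ \<mu>] exI[of _ "g * path_weight m \<xi>"] exI[of _ "\<nu> + \<xi>"])
          (simp add: monomial_val_def affine_eq_iff path_weight_plus path_degree_plus)
    qed
  qed
  then show ?thesis by (metis word.collapse)
qed

text \<open>Expanding a fraction: s s* = 1 is inserted before the starred path, and
  \<open>U g\<close> is moved past s.\<close>

lemma monomial_expand: "monomial \<mu> g \<nu> = monomial (\<mu> + \<xi>) (g * path_weight m \<xi>) (\<nu> + \<xi>)"
proof -
  have "monomial (\<mu> + \<xi>) (g * path_weight m \<xi>) (\<nu> + \<xi>) =
      \<iota> (S \<mu>) * (\<iota> (S \<xi>) * \<iota> (U (g * path_weight m \<xi>))) * adj (\<iota> (S \<xi>)) * adj (\<iota> (S \<nu>))"
    by (simp add: monomial_def S_plus adj_mult mult.assoc)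
  also have "\<dots> = \<iota> (S \<mu>) * \<iota> (U g) * (\<iota> (S \<xi>) * adj (\<iota> (S \<xi>))) * adj (\<iota> (S \<nu>))"
    by (simp only: mult.assoc flip: U_mult_S)
  finally show ?thesis by (simp add: S_mult_adj monomial_def)
qed

text \<open>The translation is a fraction with denominator \<open>weight \<mu>\<close>, so each
  monomial is expanded by the denominator path of the other; equal values then give literally the
  same monomial.\<close>

lemma eval_word_eq_if_val_eq:
  assumes "val v = val w"
  shows "eval_word \<iota> v = eval_word \<iota> w"
proof -
  obtain \<mu> g \<nu> where v: "eval_word \<iota> v = monomial \<mu> g \<nu>" "val v = monomial_val \<mu> g \<nu>"
    using word_normal_form by blast
  obtain \<mu>' g' \<nu>' where w: "eval_word \<iota> w = monomial \<mu>' g' \<nu>'" "val w = monomial_val \<mu>' g' \<nu>'"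
    using word_normal_form by blast
  have eq: "rat_of_int g / weight \<mu> = rat_of_int g' / weight \<mu>'"
    "path_degree \<mu> - path_degree \<nu> = path_degree \<mu>' - path_degree \<nu>'"
    using assms v(2) w(2) by (simp_all add: monomial_val_def affine_eq_iff)
  have "rat_of_int (g * path_weight m \<mu>') = rat_of_int (g' * path_weight m \<mu>)"
    using eq(1) by (simp add: field_simps)
  then have "g * path_weight m \<mu>' = g' * path_weight m \<mu>" by (simp only: of_int_eq_iff)
  moreover have "\<nu> + \<mu>' = \<nu>' + \<mu>"
    using eq(2) by (intro path_degree_inj) (simp add: path_degree_plus algebra_simps)
  ultimately show ?thesis
    unfolding v(1) w(1)
    using monomial_expand[of \<mu> g \<nu> \<mu>'] monomial_expand[of \<mu>' g' \<nu>' \<mu>] by (simp add: add.commute)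
qed

text \<open>The coordinates of the type are independent, but on word values the degree fixes the
  scale: degree zero means \<mu> = \<nu> in the normal form.\<close>

lemma scale_eq_one_if_deg_zero: "aff_deg (val w) = 0 \<Longrightarrow> aff_scale (val w) = 1"
proof -
  assume d: "aff_deg (val w) = 0"
  obtain \<mu> g \<nu> where "val w = monomial_val \<mu> g \<nu>" using word_normal_form by blast
  then show ?thesis using d path_degree_inj[of \<mu> \<nu>] by (simp add: monomial_val_def)
qed

text \<open>Word values of degree zero form \<open>N\<close>. Their scale is 1, so composition adds
  the translations, and the translation determines the element.\<close>

sublocale abelian_by_abelian_rep "affine_gen m" \<iota> aff_deg aff_trans
proof unfold_locales
  show "eval_word \<iota> v = eval_word \<iota> w" if "val v = val w" for v w
    using that by (rule eval_word_eq_if_val_eq)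
qed (simp_all add: scale_eq_one_if_deg_zero affine_eq_iff)

text \<open>The two sides of each relation have the same value in the affine group, so their
  coefficients cancel.\<close>

lemma red_relators:
  assumes "r \<in> relators m"
  shows "red (affine_gen m) r = 0"
proof (rule red_eq_zero)
  fix g
  have R: "affine_gen m (U (k + l)) = affine_gen m (U k) + affine_gen m (U l)"
    "affine_gen m (S (\<mu> + \<nu>)) = affine_gen m (S \<mu>) + affine_gen m (S \<nu>)"
    "affine_gen m (U k) + affine_gen m (S \<mu>) = affine_gen m (S \<mu>) + affine_gen m (U (restriction m k \<mu>))"
    for k l \<mu> \<nu>
    by (simp_all add: affine_eq_iff path_weight_plus path_degree_plus restriction_eq)
  show "coef (affine_gen m) g r = 0"
    using assms unfolding relators_def
    by (elim UnE; clarsimp simp: gen_def star_free_single mult_single coef_diff coef_single coef_one R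
        simp del: affine_gen.simps split: if_splits)
qed

text \<open>Maximality of the universal seminorm gives one inequality of norms and the growth
  argument the other. The scale is multiplicative, so its fibres are the cosets of its kernel, which
  on word values is \<open>H\<close>.\<close>

sublocale reduced_algebra_expectation "affine_gen m" \<iota> aff_scale
proof unfold_locales
  fix p
  have "red (affine_gen m) p \<le> norm (eval_free \<iota> p)"
    using universal cstar_seminorm_red red_relators unfolding universal_cstar_algebra_def by blast
  then show "norm (eval_free \<iota> p) = red (affine_gen m) p"
    using norm_eval_le_red[of p] by (rule antisym[rotated])
next
  show "closure (range (eval_free \<iota>)) = UNIV"
    using universal dense_range_eval unfolding universal_cstar_algebra_def by blast
qed simp

section \<open>The subalgebra C*(H) and the relative commutant\<close>

definition diagonal :: "'a set" where
  "diagonal = {x. expect x = x}"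

lemma diagonal_iff: "x \<in> diagonal \<longleftrightarrow> (\<forall>g. aff_scale g \<noteq> 1 \<longrightarrow> fourier g x = 0)"
proof
  assume "x \<in> diagonal"
  then have "expect x = x" by (simp add: diagonal_def)
  then show "\<forall>g. aff_scale g \<noteq> 1 \<longrightarrow> fourier g x = 0" by (metis fourier_expect affine_simps(2))
next
  assume "\<forall>g. aff_scale g \<noteq> 1 \<longrightarrow> fourier g x = 0"
  then have "expect x = x" by (intro fourier_eq_imp) (simp add: fourier_expect)
  then show "x \<in> diagonal" by (simp add: diagonal_def)
qed

text \<open>Values of scale 1 compose by adding translations and degrees, hence commute, and
  evaluation depends on the value alone.\<close>

lemma abelian_diagonal: "abelian diagonal"
proof -
  have comm: "expect x * expect y = expect y * expect x" for x y
  proof (rule eq_on_eval[of "\<lambda>x. expect x * expect y"])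
    fix p
    show "expect (eval_free \<iota> p) * expect y = expect y * expect (eval_free \<iota> p)"
    proof (rule eq_on_eval[of "\<lambda>y. expect (eval_free \<iota> p) * expect y"])
      fix r
      have "eval_word \<iota> v * eval_word \<iota> w = eval_word \<iota> w * eval_word \<iota> v"
        if "aff_scale (val v) = 1" "aff_scale (val w) = 1" for v w
        using that eval_word_eq_if_val_eq[of "v + w" "w + v"]
        by (simp add: eval_word_plus affine_eq_iff add.commute)
      then have "eval_free \<iota> (kernel_part p) * eval_free \<iota> (kernel_part r) =
          eval_free \<iota> (kernel_part r) * eval_free \<iota> (kernel_part p)"
        by (intro eval_free_commute) (simp add: keys_restrict_words)
      then show "expect (eval_free \<iota> p) * expect (eval_free \<iota> r) =
          expect (eval_free \<iota> r) * expect (eval_free \<iota> p)" by simp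
    qed (auto intro!: continuous_intros)
  qed (auto intro!: continuous_intros)
  show ?thesis
    unfolding abelian_def diagonal_def
  proof (intro ballI)
    fix x y assume "x \<in> {x. expect x = x}" "y \<in> {x. expect x = x}"
    then show "x * y = y * x" using comm[of x y] by simp
  qed
qed

lemma cstar_subalgebra_diagonal: "cstar_subalgebra diagonal"
proof -
  have "closed diagonal"
    unfolding diagonal_def by (intro closed_Collect_eq continuous_intros)
  moreover have "expect (x * y) = x * y" if "expect x = x" "expect y = y" for x y
    using expect_mult_left[of x y] that by simp
  moreover have "expect 0 = 0" using expect_scaleC[of 0 0] by simp
  ultimately show ?thesis
    unfolding cstar_subalgebra_def by (auto simp: diagonal_def expect_add expect_scaleC expect_adj)
qed

lemma gauge_action:
  assumes "t \<in> torus"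
  shows "star_automorphism (gauge_action \<iota> t)" "continuous_on UNIV (gauge_action \<iota> t)"
    "gauge_action \<iota> t (monomial \<mu> g \<nu>) = gauge_char t \<mu> \<nu> *\<^sub>C monomial \<mu> g \<nu>"
  using theI'[OF ex1_gauge_action[OF universal assms]]
  unfolding gauge_action_def[symmetric] monomial_def by auto

lemma gauge_action_eval_word:
  assumes "t \<in> torus"
  shows "gauge_action \<iota> t (eval_word \<iota> w) = torus_char t (aff_deg (val w)) *\<^sub>C eval_word \<iota> w"
proof -
  obtain \<mu> g \<nu> where w: "eval_word \<iota> w = monomial \<mu> g \<nu>" "val w = monomial_val \<mu> g \<nu>"
    using word_normal_form by blast
  then have "torus_char t (aff_deg (val w)) = gauge_char t \<mu> \<nu>"
    by (simp add: monomial_val_def torus_char_def gauge_char_def path_degree_def)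
  then show ?thesis using gauge_action(3)[OF assms] w by simp
qed

text \<open>The gauge action is dual to the degree homomorphism: every word is an eigenvector, with
  a character of its degree as eigenvalue.\<close>

lemma fourier_gauge_action:
  assumes t: "t \<in> torus"
  shows "fourier g (gauge_action \<iota> t x) = torus_char t (aff_deg g) * fourier g x"
proof (rule eq_on_eval[of "\<lambda>x. fourier g (gauge_action \<iota> t x)"])
  have hom: "gauge_action \<iota> t (x + y) = gauge_action \<iota> t x + gauge_action \<iota> t y"
    "gauge_action \<iota> t (c *\<^sub>C x) = c *\<^sub>C gauge_action \<iota> t x" for x y c
    using gauge_action(1)[OF t] by (auto simp: star_automorphism_def star_hom_def)
  fix p
  show "fourier g (gauge_action \<iota> t (eval_free \<iota> p)) =
      torus_char t (aff_deg g) * fourier g (eval_free \<iota> p)"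
  proof (induction p rule: free_induct)
    case zero
    then show ?case using hom(2)[of 0 0] by simp
  next
    case (single w c)
    have "gauge_action \<iota> t (eval_free \<iota> (Poly_Mapping.single w c)) =
        eval_free \<iota> (Poly_Mapping.single w (c * torus_char t (aff_deg (val w))))"
      by (simp add: eval_free_single hom gauge_action_eval_word[OF t] scaleC_scaleC)
    then show ?case by (simp add: coef_single)
  next
    case (add p r)
    then show ?case by (simp add: eval_free_add hom fourier_add distrib_left coef_add flip: fourier_eval)
  qed
qed (use gauge_action(2)[OF t] in \<open>auto intro!: continuous_intros\<close>)

lemma gauge_fixed_subset_diagonal: "gauge_fixed_algebra \<iota> \<subseteq> diagonal"
proof
  fix x assume x: "x \<in> gauge_fixed_algebra \<iota>"
  show "x \<in> diagonal"
    unfolding diagonal_iff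
  proof (intro allI impI)
    fix g :: "'k affine" assume g: "aff_scale g \<noteq> 1"
    show "fourier g x = 0"
    proof (cases "aff_deg g = 0")
      case True
      \<comment> \<open>Such a triple is the value of no word, so its coefficient vanishes on the
        dense subalgebra.\<close>
      then have "g \<notin> supp (affine_gen m) p" for p using g scale_eq_one_if_deg_zero by auto
      then have "fourier g (eval_free \<iota> p) = 0" for p by (simp only: fourier_eval coef_eq_zero not_False_eq_True)
      then show ?thesis
        by (rule eq_on_eval[of "fourier g" "\<lambda>_. 0", rotated 2]) (auto intro!: continuous_intros)
    next
      case False
      then obtain t where t: "t \<in> torus" "torus_char t (aff_deg g) \<noteq> 1" using torus_char_separates by blast
      then have "fourier g x = torus_char t (aff_deg g) * fourier g x"
        using fourier_gauge_action[OF t(1), of g x] x by (simp add: gauge_fixed_algebra_def)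
      then show ?thesis using t(2) by simp
    qed
  qed
qed

lemma U_in_gauge_fixed: "\<iota> (U g) \<in> gauge_fixed_algebra \<iota>"
  using gauge_action_eval_word[of _ "letter_word (U g)"]
  by (simp add: gauge_fixed_algebra_def scaleC_one)

text \<open>Commuting with \<open>u\<^sub>a\<close> makes the Fourier coefficients constant along the conjugacy orbits of \<open>a\<close>,
  which are infinite off the diagonal.\<close>

lemma commutes_U_imp_diagonal:
  assumes comm: "x * \<iota> (U 1) = \<iota> (U 1) * x"
  shows "x \<in> diagonal"
  unfolding diagonal_iff
proof (intro allI impI)
  fix g :: "'k affine" assume g: "aff_scale g \<noteq> 1"
  let ?u = "affine_gen m (U 1)"
  have inv: "fourier (?u + k - ?u) x = fourier k x" for k
  proof -
    have "eval_free \<iota> (Poly_Mapping.single (letter_word (U 1)) 1) = \<iota> (U 1)"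
      by (simp add: eval_free_single scaleC_one)
    then show ?thesis
      using fourier_single_mult[of "?u + k" "letter_word (U 1)" 1 x]
        fourier_mult_single[of "?u + k" x "letter_word (U 1)" 1] comm
      by (simp del: affine_gen.simps)
  qed
  \<comment> \<open>The \<open>n\<close>-fold conjugate of \<open>g\<close> by the translation by 1:
    each conjugation adds \<open>1 - aff_scale g\<close>, which is nonzero here.\<close>
  define f where "f n = mk_aff (aff_trans g + of_nat n * (1 - aff_scale g)) (aff_scale g) (aff_deg g)" for n
  have f_Suc: "f (Suc n) = ?u + f n - ?u" for n
    by (simp add: f_def affine_eq_iff algebra_simps)
  have f: "fourier (f n) x = fourier g x" for n
  proof (induction n)
    case 0
    have "f 0 = g" by (simp add: f_def affine_eq_iff)
    then show ?case by simp
  qed (simp only: f_Suc inv)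
  have inj: "inj f" using g by (auto simp: inj_def f_def affine_eq_iff)
  have le: "real N * (cmod (fourier g x))\<^sup>2 \<le> (norm x)\<^sup>2" for N
  proof -
    have "(\<Sum>k\<in>f ` {..<N}. (cmod (fourier k x))\<^sup>2) = (\<Sum>n<N. (cmod (fourier (f n) x))\<^sup>2)"
      using inj by (subst sum.reindex) (auto intro: inj_on_subset)
    then show ?thesis using fourier_bessel[of "f ` {..<N}" x] by (simp add: f)
  qed
  show "fourier g x = 0"
  proof (rule ccontr)
    assume "fourier g x \<noteq> 0"
    then have "(cmod (fourier g x))\<^sup>2 > 0" by simp
    then obtain N where "real N * (cmod (fourier g x))\<^sup>2 > (norm x)\<^sup>2" using reals_Archimedean3 by blast
    then show False using le[of N] by simp
  qed
qed

lemma rel_commutant_gauge_fixed: "rel_commutant (gauge_fixed_algebra \<iota>) = diagonal"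
proof
  show "rel_commutant (gauge_fixed_algebra \<iota>) \<subseteq> diagonal"
    using commutes_U_imp_diagonal U_in_gauge_fixed by (auto simp: rel_commutant_def)
  show "diagonal \<subseteq> rel_commutant (gauge_fixed_algebra \<iota>)"
    using abelian_diagonal gauge_fixed_subset_diagonal by (auto simp: rel_commutant_def abelian_def)
qed

section \<open>The Cartan axioms\<close>

text \<open>The fixed-point algebra lies in the diagonal, so an abelian \<open>C\<close> above the
  diagonal commutes with it and falls into the relative commutant, which is the diagonal
  again.\<close>

lemma masa_diagonal: "masa diagonal"
  unfolding masa_def
proof (intro conjI allI impI)
  fix C assume C: "cstar_subalgebra C \<and> abelian C \<and> diagonal \<subseteq> C"
  then have "C \<subseteq> rel_commutant (gauge_fixed_algebra \<iota>)"
    using gauge_fixed_subset_diagonal by (auto simp: rel_commutant_def abelian_def)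
  then show "C = diagonal" using C by (simp add: rel_commutant_gauge_fixed)
qed (simp_all add: cstar_subalgebra_diagonal abelian_diagonal)

text \<open>\<open>H\<close> is normal, being the kernel of the scale, so conjugation by a word only
  permutes the coefficients within each scale.\<close>

lemma eval_word_conj_diagonal:
  assumes "x \<in> diagonal"
  shows "eval_word \<iota> w * x * adj (eval_word \<iota> w) \<in> diagonal"
  unfolding diagonal_iff
proof (intro allI impI)
  fix g :: "'k affine" assume "aff_scale g \<noteq> 1"
  have e: "eval_free \<iota> (Poly_Mapping.single w 1) = eval_word \<iota> w"
    "eval_free \<iota> (Poly_Mapping.single (star_word w) 1) = adj (eval_word \<iota> w)"
    by (simp_all add: eval_free_single scaleC_one eval_word_star)
  have "fourier g (eval_word \<iota> w * (x * adj (eval_word \<iota> w))) = fourier (- val w + g + val w) x"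
    using fourier_single_mult[of g w 1] fourier_mult_single[of "- val w + g" x "star_word w" 1]
    by (simp add: e)
  moreover have "aff_scale (- val w + g + val w) = aff_scale g" by simp
  ultimately show "fourier g (eval_word \<iota> w * x * adj (eval_word \<iota> w)) = 0"
    using assms \<open>aff_scale g \<noteq> 1\<close> unfolding diagonal_iff by (metis mult.assoc)
qed

lemma eval_word_in_normalizer: "eval_word \<iota> w \<in> normalizer_set diagonal"
  using eval_word_conj_diagonal[of _ w] eval_word_conj_diagonal[of _ "star_word w"]
  by (simp add: normalizer_set_def eval_word_star adj_adj)

lemma normalizer_diagonal_generates: "cstar_generated (normalizer_set diagonal) = UNIV"
proof -
  have "insert 1 (range \<iota>) \<subseteq> normalizer_set diagonal"
    using eval_word_in_normalizer[of 0] eval_word_in_normalizer[of "letter_word _"] by auto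
  then have "cstar_generated (insert 1 (range \<iota>)) \<subseteq> cstar_generated (normalizer_set diagonal)"
    unfolding cstar_generated_def by blast
  then show ?thesis using universal unfolding universal_cstar_algebra_def by auto
qed

text \<open>The unit lies in the diagonal, so the constant net at 1 will do; its image filter is
  \<open>principal {1}\<close>.\<close>

lemma approximate_unit_diagonal: "contains_approximate_unit diagonal"
proof -
  have "positive (1::'a)" unfolding positive_def by (rule exI[of _ 1]) simp
  then show ?thesis
    unfolding contains_approximate_unit_def
    by (intro exI[of _ "principal {1}"])
      (auto simp: eventually_principal principal_eq_bot_iff diagonal_def
        intro!: topological_tendstoI)
qed

theorem cartan_diagonal: "cartan_subalgebra diagonal"
  unfolding cartan_subalgebra_def
  using cstar_subalgebra_diagonal abelian_diagonal approximate_unit_diagonal masa_diagonal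
    normalizer_diagonal_generates conditional_expectation_expect[OF diagonal_def] faithful_expect
  by blast

end

theorem theorem4p22:
  fixes m :: "'k::finite \<Rightarrow> int"
    and \<iota> :: "'k generator \<Rightarrow> 'a::unital_cstar_algebra"
  assumes "\<And>i. m i \<noteq> 0"
    and "universal_cstar_algebra (relators m) \<iota>"
  shows "cartan_subalgebra (rel_commutant (gauge_fixed_algebra \<iota>))"
proof -
  interpret self_similar_algebra m \<iota> using assms by unfold_locales
  show ?thesis unfolding rel_commutant_gauge_fixed by (rule cartan_diagonal)
qed

end
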